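(* Let $X$ be a nonzero complex Banach space with open unit ball $\mathbb{B}$, let $0\le\alpha<1$, and let $F:\mathbb{B}\to X$ be a locally biholomorphic mapping satisfying $$\frac{D^{k+1}F(0)(x^{k+1})}{(k+1)!}=H_{F,k}(x)\,x,\qquad x\in X,\quad k=1,2,3,$$ where each $H_{F,k}$ is a homogeneous polynomial of degree $k$ on $X$ with values in $\mathbb{C}$. If $F\in\mathcal{S}^*_{\mathbb{B}}(\alpha)$, then for every $x_0\in X$ with $\|x_0\|=1$ and every $T_{x_0}\in T(x_0)$, the quantity $J_{2,3}(F)=A_2A_3-A_4$ satisfies $$|J_{2,3}(F)|\le\begin{cases}\dfrac{2}{3}(1-\alpha)\big[4(1-\alpha)^2-1\big], & 0\le\alpha\le 1-\dfrac{\sqrt3}{2},\\[3mm] \dfrac{2(1-\alpha)}{3\sqrt{1-(1-\alpha)^2}}, & 1-\dfrac{\sqrt3}{2}<\alpha<1.\end{cases}$$ Moreover, the estimate is sharp: for every nonzero complex Banach space $X$ and every $0\le\alpha<1$ there are a locally biholomorphic mapping $F\in\mathcal{S}^*_{\mathbb{B}}(\alpha)$ with $\frac{D^{k+1}F(0)(x^{k+1})}{(k+1)!}=H_{F,k}(x)\,x$ for all $x\in X$ and $k=1,2,3$, where each $H_{F,k}$ is a $\mathbb{C}$-valued homogeneous polynomial of degree $k$ on $X$, a unit vector $x_0$ and $T_{x_0}\in T(x_0)$ for which equality holds in this bound on $|J_{2,3}(F)|$.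
   Context: $X$ is a complex Banach space with norm $\|\cdot\|$ and $\mathbb{B}=\{x\in X:\|x\|<1\}$. For $x\in X\setminus\{0\}$, $T(x)$ is the (nonempty) set of bounded linear functionals $T_x:X\to\mathbb{C}$ with $\|T_x\|=1$ and $T_x(x)=\|x\|$. For holomorphic $F:\mathbb{B}\to X$, $DF(x)$ is the Fréchet derivative at $x$, $D^nF(x)$ is the $n$th Fréchet derivative (a bounded symmetric $n$-linear map $X^n\to X$), and $D^nF(0)(x^n)=D^nF(0)(x,\ldots,x)$. $F$ is normalized if $F(0)=0$ and $DF(0)=I$ (the identity), and locally biholomorphic if it is holomorphic and $DF(x)$ is invertible with bounded inverse for every $x\in\mathbb{B}$. Class $\mathcal{S}^*_{\mathbb{B}}(\alpha)$ (starlike mappings of order $\alpha$): for $0<\alpha<1$, the set of normalized locally biholomorphic $F:\mathbb{B}\to X$ such that $$\left|\frac{1}{\|x\|}T_x\big((DF(x))^{-1}F(x)\big)-\frac{1}{2\alpha}\right|<\frac{1}{2\alpha}\quad\text{for all }x\in\mathbb{B}\setminus\{0\},\ T_x\in T(x);$$ equivalently, $\operatorname{Re}\big(\|x\|/T_x((DF(x))^{-1}F(x))\big)>\alpha$ for all such $x,T_x$. For $\alpha=0$, $\mathcal{S}^*_{\mathbb{B}}(0)=\mathcal{S}^*_{\mathbb{B}}$ is the set of normalized locally biholomorphic $F$ with $\operatorname{Re}\,T_x((DF(x))^{-1}F(x))>0$ for all $x\in\mathbb{B}\setminus\{0\}$, $T_x\in T(x)$. Given $x_0$ with $\|x_0\|=1$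 and $T_{x_0}\in T(x_0)$, put $A_n=\frac{1}{n!}T_{x_0}\big(D^nF(0)(x_0^n)\big)$ for $n=2,3,4$. *)

theory Defs
  imports "HOL-Analysis.Analysis"
begin

class complex_vector = real_vector +
  fixes scaleC :: "complex \<Rightarrow> 'a \<Rightarrow> 'a" (infixr "*\<^sub>C" 75)
  assumes scaleC_add_right: "c *\<^sub>C (x + y) = c *\<^sub>C x + c *\<^sub>C y"
    and scaleC_add_left: "(c + d) *\<^sub>C x = c *\<^sub>C x + d *\<^sub>C x"
    and scaleC_scaleC: "c *\<^sub>C d *\<^sub>C x = (c * d) *\<^sub>C x"
    and scaleC_of_real: "complex_of_real r *\<^sub>C x = r *\<^sub>R x"

class complex_normed_vector = complex_vector + real_normed_vector +
  assumes norm_scaleC: "norm (c *\<^sub>C x) = cmod c * norm x"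

class complex_banach = complex_normed_vector + banach

instantiation complex :: complex_banach
begin

definition scaleC_complex :: "complex \<Rightarrow> complex \<Rightarrow> complex" where
  "scaleC_complex c x = c * x"

instance
  by standard
    (auto simp: scaleC_complex_def algebra_simps norm_mult scaleR_conv_of_real)

end

definition bounded_clinear ::
    "('a::complex_normed_vector \<Rightarrow> 'b::complex_normed_vector) \<Rightarrow> bool" where
  "bounded_clinear f \<longleftrightarrow> bounded_linear f \<and> (\<forall>c x. f (c *\<^sub>C x) = c *\<^sub>C f x)"

definition support_functionals :: "'a::complex_normed_vector \<Rightarrow> ('a \<Rightarrow> complex) set" where
  "support_functionals x =
     {T. bounded_clinear T \<and> onorm T = 1 \<and> T x = complex_of_real (norm x)}"

text \<open>
  Multilinear forms take their arguments as a list of length \<open>k\<close>.  Boundedness of the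
  form is part of the notion of a homogeneous polynomial, as usual on Banach spaces.
\<close>

definition bounded_cmultilinear ::
    "nat \<Rightarrow> ('a::complex_normed_vector list \<Rightarrow> complex) \<Rightarrow> bool" where
  "bounded_cmultilinear k L \<longleftrightarrow>
     (\<forall>xs. length xs = k \<longrightarrow> (\<forall>i<k. bounded_clinear (\<lambda>x. L (xs[i := x])))) \<and>
     (\<exists>C. \<forall>xs. length xs = k \<longrightarrow> cmod (L xs) \<le> C * prod_list (map norm xs))"

definition homogeneous_polynomial ::
    "nat \<Rightarrow> ('a::complex_normed_vector \<Rightarrow> complex) \<Rightarrow> bool" where
  "homogeneous_polynomial k P \<longleftrightarrow>
     (\<exists>L. bounded_cmultilinear k L \<and> (\<forall>x. P x = L (replicate k x)))"

text \<open>
  The Frechet derivative as an element of the normed space of bounded operators, so that it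
  can be iterated: \<open>fderiv (fderiv F) x\<close> is the second derivative, with values in
  \<open>'a \<Rightarrow>\<^sub>L 'a \<Rightarrow>\<^sub>L 'b\<close>, and so on.  It is the real derivative, which for a holomorphic map
  is the complex one.  At points where \<open>F\<close> is not differentiable the value is arbitrary.
\<close>

definition fderiv ::
    "('a::real_normed_vector \<Rightarrow> 'b::real_normed_vector) \<Rightarrow> 'a \<Rightarrow> 'a \<Rightarrow>\<^sub>L 'b" where
  "fderiv F x = Blinfun (frechet_derivative F (at x))"

definition fderiv2_diag ::
    "('a::real_normed_vector \<Rightarrow> 'b::real_normed_vector) \<Rightarrow> 'a \<Rightarrow> 'a \<Rightarrow> 'b" where
  "fderiv2_diag F a x = fderiv (fderiv F) a x x"

definition fderiv3_diag ::
    "('a::real_normed_vector \<Rightarrow> 'b::real_normed_vector) \<Rightarrow> 'a \<Rightarrow> 'a \<Rightarrow> 'b" where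
  "fderiv3_diag F a x = fderiv (fderiv (fderiv F)) a x x x"

definition fderiv4_diag ::
    "('a::real_normed_vector \<Rightarrow> 'b::real_normed_vector) \<Rightarrow> 'a \<Rightarrow> 'a \<Rightarrow> 'b" where
  "fderiv4_diag F a x = fderiv (fderiv (fderiv (fderiv F))) a x x x x"

text \<open>
  Maps on the open unit ball are total functions; only their values on \<open>ball 0 1\<close> matter.
\<close>

definition holomorphic_on_ball ::
    "('a::complex_normed_vector \<Rightarrow> 'b::complex_normed_vector) \<Rightarrow> bool" where
  "holomorphic_on_ball F \<longleftrightarrow>
     (\<forall>x\<in>ball 0 1. \<exists>D. bounded_clinear D \<and> (F has_derivative D) (at x))"

definition normalized :: "('a::complex_normed_vector \<Rightarrow> 'a) \<Rightarrow> bool" where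
  "normalized F \<longleftrightarrow> F 0 = 0 \<and> fderiv F 0 = id_blinfun"

definition locally_biholomorphic :: "('a::complex_normed_vector \<Rightarrow> 'a) \<Rightarrow> bool" where
  "locally_biholomorphic F \<longleftrightarrow>
     holomorphic_on_ball F \<and>
     (\<forall>x\<in>ball 0 1. bij (blinfun_apply (fderiv F x)) \<and>
                    bounded_linear (inv (blinfun_apply (fderiv F x))))"

definition starlike_of_order :: "real \<Rightarrow> ('a::complex_normed_vector \<Rightarrow> 'a) set" where
  "starlike_of_order \<alpha> =
     {F. normalized F \<and> locally_biholomorphic F \<and>
         (\<forall>x\<in>ball 0 1 - {0}. \<forall>T\<in>support_functionals x.
            if \<alpha> = 0
            then Re (T (inv (blinfun_apply (fderiv F x)) (F x))) > 0
            else cmod (1 / complex_of_real (norm x)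
                         * T (inv (blinfun_apply (fderiv F x)) (F x))
                       - 1 / (2 * complex_of_real \<alpha>)) < 1 / (2 * \<alpha>))}"

text \<open>\<open>H k\<close> is the scalar polynomial \<open>H\<^bsub>F,k\<^esub>\<close>, for \<open>k = 1, 2, 3\<close>.\<close>

definition radial_expansion ::
    "('a::complex_normed_vector \<Rightarrow> 'a) \<Rightarrow> (nat \<Rightarrow> 'a \<Rightarrow> complex) \<Rightarrow> bool" where
  "radial_expansion F H \<longleftrightarrow>
     (\<forall>k\<in>{1, 2, 3}. homogeneous_polynomial k (H k)) \<and>
     (\<forall>x. (1 / fact 2) *\<^sub>R fderiv2_diag F 0 x = H 1 x *\<^sub>C x) \<and>
     (\<forall>x. (1 / fact 3) *\<^sub>R fderiv3_diag F 0 x = H 2 x *\<^sub>C x) \<and>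
     (\<forall>x. (1 / fact 4) *\<^sub>R fderiv4_diag F 0 x = H 3 x *\<^sub>C x)"

definition J23 ::
    "('a::complex_normed_vector \<Rightarrow> 'a) \<Rightarrow> 'a \<Rightarrow> ('a \<Rightarrow> complex) \<Rightarrow> complex" where
  "J23 F x0 T =
     (let A2 = T (fderiv2_diag F 0 x0) / fact 2;
          A3 = T (fderiv3_diag F 0 x0) / fact 3;
          A4 = T (fderiv4_diag F 0 x0) / fact 4
      in A2 * A3 - A4)"

definition J23_bound :: "real \<Rightarrow> real" where
  "J23_bound \<alpha> =
     (if \<alpha> \<le> 1 - sqrt 3 / 2
      then 2 / 3 * (1 - \<alpha>) * (4 * (1 - \<alpha>)\<^sup>2 - 1)
      else 2 * (1 - \<alpha>) / (3 * sqrt (1 - (1 - \<alpha>)\<^sup>2)))"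

end

theory Submission
  imports Defs "HOL-Complex_Analysis.Complex_Analysis"
begin

text \<open>
  Upper bound: restrict to the line through \<open>x\<^sub>0\<close>.  Since the Taylor terms of \<open>F\<close> are radial, the
  function \<open>p(\<zeta>) = \<zeta> / T(DF(\<zeta>x\<^sub>0)\<^sup>-\<^sup>1 F(\<zeta>x\<^sub>0))\<close> agrees up to third order with \<open>\<zeta>f'(\<zeta>)/f(\<zeta>)\<close>, where
  \<open>f = \<zeta> + A\<^sub>2\<zeta>\<^sup>2 + A\<^sub>3\<zeta>\<^sup>3 + A\<^sub>4\<zeta>\<^sup>4\<close>; comparing coefficients gives \<open>3 (A\<^sub>2A\<^sub>3 - A\<^sub>4) = p\<^sub>1\<^sup>3 - p\<^sub>3\<close>.
  As \<open>Re p > \<alpha>\<close> and \<open>p(0) = 1\<close>, testing \<open>Re p - \<alpha>\<close> against the nonnegative trigonometric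
  polynomial \<open>4 (cos \<theta> - t)\<^sup>2 (cos \<theta> + 2t)\<close>, \<open>t \<ge> 1/2\<close>, which has no \<open>cos 2\<theta>\<close> term, bounds \<open>p\<^sub>3\<close> in terms
  of \<open>p\<^sub>1\<close>; a rotation reduces to the case where \<open>p\<^sub>1\<^sup>3 - p\<^sub>3\<close> is nonnegative and \<open>Re p\<^sub>1 \<ge> 0\<close>.

  Sharpness: take \<open>F(x) = \<Psi>(T x) x\<close>, where \<open>1 + \<zeta>\<Psi>'/\<Psi>\<close> is the function with two atoms
  \<open>t \<plusminus> i sqrt (1 - t\<^sup>2)\<close> at which the trigonometric polynomial vanishes.

  The iterated derivatives exist because a holomorphic map has a holomorphic Frechet derivative.
  This is obtained from scalar Cauchy theory: the Hahn-Banach theorem transfers the Cauchy integral for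
  \<open>DF(x)h\<close> to Banach space values, and that formula can be differentiated in \<open>x\<close>.
\<close>

section \<open>Complex scalars and the Hahn-Banach theorem\<close>

lemma scaleC_complex [simp]: "c *\<^sub>C (z::complex) = c * z"
  by (simp add: scaleC_complex_def)

lemma scaleC_zero_left [simp]: "(0::complex) *\<^sub>C (x::'a::complex_vector) = 0"
  using scaleC_of_real[of 0 x] by simp

lemma scaleC_one [simp]: "(1::complex) *\<^sub>C (x::'a::complex_vector) = x"
  using scaleC_of_real[of 1 x] by simp

lemma bounded_bilinear_scaleC:
  "bounded_bilinear (\<lambda>c (x::'a::complex_normed_vector). c *\<^sub>C x)"
proof
  fix r :: real and c :: complex and x :: 'a
  show "(r *\<^sub>R c) *\<^sub>C x = r *\<^sub>R (c *\<^sub>C x)"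
    by (simp add: scaleC_of_real[symmetric] scaleC_scaleC scaleR_conv_of_real)
  show "c *\<^sub>C (r *\<^sub>R x) = r *\<^sub>R (c *\<^sub>C x)"
    by (simp add: scaleC_of_real[symmetric] scaleC_scaleC mult.commute)
qed (auto simp: scaleC_add_left scaleC_add_right norm_scaleC intro: exI[of _ 1])

interpretation scaleC: bounded_bilinear "\<lambda>c (x::'a::complex_normed_vector). c *\<^sub>C x"
  by (rule bounded_bilinear_scaleC)

lemma bounded_clinearD:
  assumes "bounded_clinear f"
  shows "bounded_linear f" "f (c *\<^sub>C x) = c *\<^sub>C f x"
  using assms by (auto simp: bounded_clinear_def)

text \<open>To iterate \<open>holomorphic_on_ball\<close>, spaces of operators must carry complex
  scalars. These act on the values; the operators are only real-linear because \<open>fderiv\<close>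
  is the real derivative.\<close>

instantiation blinfun :: (real_normed_vector, complex_normed_vector) complex_normed_vector
begin

lift_definition scaleC_blinfun :: "complex \<Rightarrow> ('a \<Rightarrow>\<^sub>L 'b) \<Rightarrow> ('a \<Rightarrow>\<^sub>L 'b)"
  is "\<lambda>c f x. c *\<^sub>C f x"
  by (rule bounded_linear_compose[OF scaleC.bounded_linear_right])

instance
proof
  fix c d :: complex and f g :: "'a \<Rightarrow>\<^sub>L 'b" and r :: real
  show "c *\<^sub>C (f + g) = c *\<^sub>C f + c *\<^sub>C g"
    by transfer (simp add: scaleC_add_right fun_eq_iff)
  show "(c + d) *\<^sub>C f = c *\<^sub>C f + d *\<^sub>C f"
    by transfer (simp add: scaleC_add_left fun_eq_iff)
  show "c *\<^sub>C d *\<^sub>C f = (c * d) *\<^sub>C f"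
    by transfer (simp add: scaleC_scaleC fun_eq_iff)
  show "complex_of_real r *\<^sub>C f = r *\<^sub>R f"
    by transfer (simp add: scaleC_of_real fun_eq_iff)
  have le: "norm (c *\<^sub>C f) \<le> cmod c * norm f" for c and f :: "'a \<Rightarrow>\<^sub>L 'b"
    by (rule norm_blinfun_bound)
       (auto simp: scaleC_blinfun.rep_eq norm_scaleC mult.assoc intro!: mult_left_mono norm_blinfun)
  show "norm (c *\<^sub>C f) = cmod c * norm f"
  proof (cases "c = 0")
    case True
    have "0 *\<^sub>C f = 0"
      by transfer simp
    then show ?thesis using True by simp
  next
    case False
    \<comment> \<open>The upper bound, applied to \<open>inverse c\<close> and the scaled operator,
      gives the reverse inequality.\<close>
    have "f = inverse c *\<^sub>C (c *\<^sub>C f)"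
      using False by transfer (simp add: scaleC_scaleC)
    then have "norm f \<le> cmod (inverse c) * norm (c *\<^sub>C f)"
      using le by metis
    then have "cmod c * norm f \<le> norm (c *\<^sub>C f)"
      using False by (simp add: norm_divide field_simps)
    then show ?thesis using le[of c f] by simp
  qed
qed

end

instance blinfun :: (real_normed_vector, complex_banach) complex_banach ..

section \<open>The Hahn-Banach theorem through minimal sublinear functionals\<close>

definition sublinear :: "('a::real_vector \<Rightarrow> real) \<Rightarrow> bool" where
  "sublinear q \<longleftrightarrow> (\<forall>x y. q (x + y) \<le> q x + q y) \<and> (\<forall>c x. c > 0 \<longrightarrow> q (c *\<^sub>R x) = c * q x)"

lemma sublinearD:
  assumes "sublinear q"
  shows "q (x + y) \<le> q x + q y" "c > 0 \<Longrightarrow> q (c *\<^sub>R x) = c * q x"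
  using assms by (auto simp: sublinear_def)

lemma sublinear_zero:
  assumes "sublinear q" shows "q 0 = 0"
  using sublinearD(2)[OF assms, of 2 0] by simp

lemma sublinear_neg:
  assumes "sublinear q" shows "- q (- x) \<le> q x"
  using sublinearD(1)[OF assms, of x "- x"] sublinear_zero[OF assms] by simp

text \<open>
  Hahn-Banach without extension from subspaces: a minimal sublinear functional is linear, because
  it equals its reduction along every \<open>y\<close>.
\<close>

lemma sublinear_reduce:
  fixes q :: "'a::real_vector \<Rightarrow> real"
  assumes q: "sublinear q"
  obtains q' where "sublinear q'" "\<And>x. q' x \<le> q x"
    "\<And>x. q' x \<le> q (x + y) - q y"
proof -
  \<comment> \<open>The reduction is the infimum of \<open>q (x + t y) - t * q y\<close> over
    \<open>t >= 0\<close>: the value at \<open>t = 0\<close> gives \<open>q' <= q\<close>, the value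
    at \<open>t = 1\<close> the bound along \<open>y\<close>.\<close>
  define S where "S x = (\<lambda>t. q (x + t *\<^sub>R y) - t * q y) ` {0..}" for x
  define q' where "q' x = Inf (S x)" for x
  have hom: "q (t *\<^sub>R x) = t * q x" if "t \<ge> 0" for t x
    using that sublinearD(2)[OF q, of t x] sublinear_zero[OF q] by (cases "t = 0") auto
  have low: "- q (- x) \<le> s" if s: "s \<in> S x" for s x
  proof -
    obtain t where t: "t \<ge> 0" "s = q (x + t *\<^sub>R y) - t * q y"
      using s by (auto simp: S_def)
    have "t * q y = q ((x + t *\<^sub>R y) + (- x))"
      using hom[of t y] t by simp
    also have "\<dots> \<le> q (x + t *\<^sub>R y) + q (- x)"
      by (rule sublinearD(1)[OF q])
    finally show ?thesis using t by simp
  qed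
  have bdd: "bdd_below (S x)" for x
    using low by (rule bdd_belowI)
  have ne: "S x \<noteq> {}" for x
    by (auto simp: S_def)
  have le: "q' x \<le> q (x + t *\<^sub>R y) - t * q y" if "t \<ge> 0" for t x
    unfolding q'_def by (rule cInf_lower[OF _ bdd]) (use that in \<open>auto simp: S_def\<close>)
  have ge: "b \<le> q' x" if "\<And>t. t \<ge> 0 \<Longrightarrow> b \<le> q (x + t *\<^sub>R y) - t * q y" for b x
    unfolding q'_def by (rule cInf_greatest[OF ne]) (use that in \<open>auto simp: S_def\<close>)
  have add: "q' (x + z) \<le> q' x + q' z" for x z
  proof -
    have "q' (x + z) - q' z \<le> q' x"
    proof (rule ge)
      fix t :: real assume t: "t \<ge> 0"
      have "q' (x + z) - (q (x + t *\<^sub>R y) - t * q y) \<le> q' z"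
      proof (rule ge)
        fix s :: real assume s: "s \<ge> 0"
        have "q' (x + z) \<le> q ((x + z) + (t + s) *\<^sub>R y) - (t + s) * q y"
          using le t s by simp
        also have "(x + z) + (t + s) *\<^sub>R y = (x + t *\<^sub>R y) + (z + s *\<^sub>R y)"
          by (simp add: algebra_simps)
        also have "q \<dots> \<le> q (x + t *\<^sub>R y) + q (z + s *\<^sub>R y)"
          by (rule sublinearD(1)[OF q])
        finally show "q' (x + z) - (q (x + t *\<^sub>R y) - t * q y) \<le> q (z + s *\<^sub>R y) - s * q y"
          by (simp add: algebra_simps)
      qed
      then show "q' (x + z) - q' z \<le> q (x + t *\<^sub>R y) - t * q y" by simp
    qed
    then show ?thesis by simp
  qed
  have hle: "c * q' x \<le> q' (c *\<^sub>R x)" if c: "c > 0" for c x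
  proof (rule ge)
    fix t :: real assume t: "t \<ge> 0"
    have "c * q' x \<le> c * (q (x + (t / c) *\<^sub>R y) - (t / c) * q y)"
      using le[of "t / c" x] t c by (intro mult_left_mono) auto
    also have "\<dots> = q (c *\<^sub>R (x + (t / c) *\<^sub>R y)) - t * q y"
      using c hom[of c "x + (t / c) *\<^sub>R y"] by (simp only: right_diff_distrib less_imp_le) simp
    finally show "c * q' x \<le> q (c *\<^sub>R x + t *\<^sub>R y) - t * q y"
      using c by (simp add: algebra_simps)
  qed
  \<comment> \<open>One inequality for all positive factors is enough; \<open>inverse c\<close>
    gives the other.\<close>
  have "q' (c *\<^sub>R x) = c * q' x" if c: "c > 0" for c x
    using hle[OF c, of x] hle[of "inverse c" "c *\<^sub>R x"] c by (simp add: field_simps)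
  then have "sublinear q'" using add by (simp add: sublinear_def)
  then show thesis
    by (rule that) (use le[of 0] le[of 1] in auto)
qed

lemma minimal_sublinear_additive:
  fixes q :: "'a::real_vector \<Rightarrow> real"
  assumes q: "sublinear q" and minimal: "\<And>q'. sublinear q' \<Longrightarrow> (\<And>x. q' x \<le> q x) \<Longrightarrow> q' = q"
  shows "q (x + y) = q x + q y"
proof -
  obtain q' where "sublinear q'" "\<And>x. q' x \<le> q x" and le: "\<And>x. q' x \<le> q (x + y) - q y"
    using sublinear_reduce[OF q, of y] by blast
  then have "q' = q" using minimal by blast
  then show ?thesis using le[of x] sublinearD(1)[OF q, of x y] by simp
qed

text \<open>Zorn's lemma for the reversed pointwise order. The infimum of a chain is finite because
  a sublinear \<open>q <= p\<close> satisfies \<open>q x >= - p (- x)\<close>, and it is subadditive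
  because any two members of the chain are comparable.\<close>

lemma exists_minimal_sublinear:
  fixes p :: "'a::real_vector \<Rightarrow> real"
  assumes p: "sublinear p"
  obtains q where "sublinear q" "\<And>x. q x \<le> p x"
    "\<And>q'. sublinear q' \<Longrightarrow> (\<And>x. q' x \<le> q x) \<Longrightarrow> q' = q"
proof -
  define A where "A = {q. sublinear q \<and> q \<le> p}"
  have "\<exists>m\<in>A. \<forall>a\<in>A. (\<lambda>x y. y \<le> x) m a \<longrightarrow> a = m"
  proof (rule predicate_Zorn)
    show "partial_order_on A (relation_of (\<lambda>x y. y \<le> x) A)"
      by (rule partial_order_on_relation_ofI) auto
    fix C assume C: "C \<in> Chains (relation_of (\<lambda>x y::'a \<Rightarrow> real. y \<le> x) A)"
    have CA: "C \<subseteq> A" by (rule Chains_relation_of[OF C])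
    have tot: "a \<le> b \<or> b \<le> a" if "a \<in> C" "b \<in> C" for a b
      using C that by (auto simp: Chains_def relation_of_def)
    show "\<exists>u\<in>A. \<forall>a\<in>C. u \<le> a"
    proof (cases "C = {}")
      case True then show ?thesis using p by (auto simp: A_def)
    next
      case False
      define u where "u x = (INF c\<in>C. c x)" for x
      have low: "- p (- x) \<le> c x" if "c \<in> C" for c x
      proof -
        have "sublinear c" "c \<le> p" using that CA by (auto simp: A_def)
        then show ?thesis using sublinear_neg[of c x] le_funD[of c p "- x"] by linarith
      qed
      have le: "u x \<le> c x" if "c \<in> C" for c x
        unfolding u_def by (rule cINF_lower[OF bdd_belowI2[OF low] that])
      have ge: "b \<le> u x" if "\<And>c. c \<in> C \<Longrightarrow> b \<le> c x" for b x
        unfolding u_def by (rule cINF_greatest[OF False that])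
      have sub: "sublinear c" if "c \<in> C" for c using that CA by (auto simp: A_def)
      have add: "u (x + y) \<le> u x + u y" for x y
      proof -
        have "u (x + y) - u y \<le> u x"
        proof (rule ge)
          fix c assume c: "c \<in> C"
          have "u (x + y) - c x \<le> u y"
          proof (rule ge)
            fix d assume d: "d \<in> C"
            obtain e where e: "e \<in> C" "e \<le> c" "e \<le> d"
              using tot[OF c d] c d by blast
            have "u (x + y) \<le> e x + e y"
              using le[OF e(1), of "x + y"] sublinearD(1)[OF sub[OF e(1)], of x y] by linarith
            also have "\<dots> \<le> c x + d y" using e by (simp add: le_funD add_mono)
            finally show "u (x + y) - c x \<le> d y" by simp
          qed
          then show "u (x + y) - u y \<le> c x" by simp
        qed
        then show ?thesis by simp
      qed
      have hle: "k * u x \<le> u (k *\<^sub>R x)" if k: "k > 0" for k x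
      proof (rule ge)
        fix c assume c: "c \<in> C"
        show "k * u x \<le> c (k *\<^sub>R x)"
          using sublinearD(2)[OF sub[OF c] k] le[OF c, of x] k by simp
      qed
      have "u (k *\<^sub>R x) = k * u x" if k: "k > 0" for k x
        using hle[OF k, of x] hle[of "inverse k" "k *\<^sub>R x"] k by (simp add: field_simps)
      moreover obtain c0 where "c0 \<in> C" using False by blast
      then have "u \<le> c0" "c0 \<le> p" using le CA by (auto simp: A_def le_fun_def)
      then have "u \<le> p" by (rule order_trans)
      ultimately have "u \<in> A" using add by (simp add: A_def sublinear_def)
      then show ?thesis using le by (auto simp: le_fun_def)
    qed
  qed
  then obtain m where m: "m \<in> A" "\<And>a. a \<in> A \<Longrightarrow> a \<le> m \<Longrightarrow> a = m" by blast
  show thesis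
  proof (rule that)
    show "sublinear m" "m x \<le> p x" for x using m(1) by (auto simp: A_def le_funD)
    show "q' = m" if "sublinear q'" "\<And>x. q' x \<le> m x" for q'
      using m that by (auto simp: A_def le_fun_def intro: order_trans)
  qed
qed

text \<open>Reducing the norm along \<open>x\<close> first gives a sublinear
  \<open>p <= norm\<close> with \<open>p (- x) <= - norm x\<close>. Every linear minorant of
  \<open>p\<close> then attains the norm at \<open>x\<close>, so nothing has to be extended from the
  span of \<open>x\<close>.\<close>

lemma real_support_functional:
  fixes x :: "'a::real_normed_vector"
  obtains f where "linear f" "\<And>y. f y \<le> norm y" "f x = norm x"
proof -
  have "sublinear (norm :: 'a \<Rightarrow> real)"
    by (auto simp: sublinear_def norm_triangle_ineq)
  then obtain p where p: "sublinear p" "\<And>y. p y \<le> norm y" "\<And>y. p y \<le> norm (y + x) - norm x"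
    using sublinear_reduce[of norm x] by blast
  obtain f where f: "sublinear f" "\<And>y. f y \<le> p y"
    "\<And>q'. sublinear q' \<Longrightarrow> (\<And>x. q' x \<le> f x) \<Longrightarrow> q' = f"
    using exists_minimal_sublinear[OF p(1)] by blast
  have add: "f (y + z) = f y + f z" for y z
    by (rule minimal_sublinear_additive[OF f(1,3)])
  have neg: "f (- y) = - f y" for y
    using add[of y "- y"] sublinear_zero[OF f(1)] by simp
  have "f (c *\<^sub>R y) = c * f y" for c y
    using sublinearD(2)[OF f(1), of c y] sublinearD(2)[OF f(1), of "- c" y] neg[of "c *\<^sub>R y"]
      sublinear_zero[OF f(1)]
    by (cases c "0::real" rule: linorder_cases) auto
  then have lin: "linear f" using add by (intro linearI) auto
  have le: "f y \<le> norm y" for y using f(2)[of y] p(2)[of y] by linarith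
  have "f (- x) \<le> - norm x" using f(2)[of "- x"] p(3)[of "- x"] by simp
  then have "f x = norm x" using neg[of x] le[of x] by linarith
  then show thesis using that lin le by blast
qed

text \<open>The real functional is complexified as \<open>f y - i f (i y)\<close>; rotating the
  argument turns the real bound into a bound on the modulus.\<close>

lemma support_functional_exists:
  fixes x :: "'a::complex_normed_vector"
  assumes "x \<noteq> 0"
  obtains T where "T \<in> support_functionals x"
proof -
  obtain f where f: "linear f" "\<And>y. f y \<le> norm y" "f x = norm x"
    using real_support_functional by blast
  define T where "T y = Complex (f y) (- f (\<i> *\<^sub>C y))" for y
  have add: "T (y + z) = T y + T z" for y z
    using f(1) by (simp add: T_def complex_eq_iff linear_add scaleC_add_right)
  have realhom: "T (r *\<^sub>R y) = r *\<^sub>R T y" for r y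
    using f(1) by (simp add: T_def complex_eq_iff linear_scale scaleC.scaleR_right)
  have ihom: "T (\<i> *\<^sub>C y) = \<i> * T y" for y
    using linear_neg[OF f(1), of y] scaleC.minus_left[of 1 y]
    by (simp add: T_def complex_eq_iff scaleC_scaleC)
  have hom: "T (c *\<^sub>C y) = c * T y" for c y
  proof -
    have "c *\<^sub>C y = (Re c + \<i> * Im c) *\<^sub>C y"
      by (rule arg_cong[OF complex_eq, where f = "\<lambda>c. c *\<^sub>C y"])
    also have "\<dots> = Re c *\<^sub>R y + Im c *\<^sub>R (\<i> *\<^sub>C y)"
      by (simp add: scaleC_of_real[symmetric] scaleC_scaleC scaleC_add_left mult.commute)
    also have "T \<dots> = (Re c + \<i> * Im c) * T y"
      by (simp add: add realhom ihom scaleR_conv_of_real algebra_simps)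
    finally show ?thesis by (simp add: complex_eq[symmetric])
  qed
  have bound: "cmod (T y) \<le> norm y" for y
  proof (cases "T y = 0")
    case False
    \<comment> \<open>This phase makes \<open>T (c y)\<close> real and nonnegative, hence equal to
      \<open>f (c y)\<close>.\<close>
    define c where "c = cnj (T y) / cmod (T y)"
    have "complex_of_real (cmod (T y)) = T (c *\<^sub>C y)"
      using False complex_norm_square[of "T y"]
      by (simp add: hom c_def power2_eq_square field_simps)
    then have "cmod (T y) = f (c *\<^sub>C y)"
      by (simp add: T_def complex_eq_iff)
    also have "\<dots> \<le> norm (c *\<^sub>C y)" by (rule f(2))
    also have "\<dots> = norm y" using False by (simp add: norm_scaleC c_def norm_divide)
    finally show ?thesis .
  qed simp
  have bl: "bounded_linear T"
    by (rule bounded_linear_intro[of _ 1]) (use add realhom bound in auto)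
  have Rex: "Re (T x) = norm x" using f(3) by (simp add: T_def)
  \<comment> \<open>The real part already equals \<open>norm x\<close>, which bounds the modulus, so
    no room is left for an imaginary part.\<close>
  have "(Im (T x))\<^sup>2 \<le> 0"
    using bound[of x] Rex cmod_power2[of "T x"] power_mono[OF bound[of x], of 2] by simp
  then have "T x = norm x" using Rex by (simp add: complex_eq_iff)
  moreover have "onorm T = 1"
  proof (rule antisym)
    show "onorm T \<le> 1" by (rule onorm_bound) (use bound in auto)
    show "1 \<le> onorm T" using onorm[OF bl, of x] \<open>T x = norm x\<close> assms by simp
  qed
  ultimately show thesis
    using that bl hom by (auto simp: support_functionals_def bounded_clinear_def)
qed

text \<open>A support functional of \<open>x - y\<close> would detect a difference. This reduces
  identities between vector-valued integrals and derivatives to scalar ones.\<close>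

lemma clinear_functionals_separate:
  fixes x y :: "'a::complex_normed_vector"
  assumes "\<And>T::'a \<Rightarrow> complex. bounded_clinear T \<Longrightarrow> T x = T y"
  shows "x = y"
proof (rule ccontr)
  assume "x \<noteq> y"
  then obtain T where T: "T \<in> support_functionals (x - y)"
    using support_functional_exists[of "x - y"] by auto
  then have "bounded_clinear T" "T (x - y) = norm (x - y)" by (auto simp: support_functionals_def)
  then show False using assms[of T] \<open>x \<noteq> y\<close> bounded_clinearD(1)[of T]
    by (simp add: bounded_linear.linear linear_diff)
qed

section \<open>The derivative of a holomorphic map is holomorphic\<close>

text \<open>The circle is traversed over \<open>[0, 1]\<close>, as by \<open>circlepath\<close>, so
  that means over it are plain integrals of total mass 1.\<close>

definition ucirc :: "real \<Rightarrow> complex" where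
  "ucirc t = exp (2 * of_real pi * \<i> * of_real t)"

lemma norm_ucirc [simp]: "cmod (ucirc t) = 1"
  by (simp add: ucirc_def)

lemma ucirc_nonzero [simp]: "ucirc t \<noteq> 0"
  by (simp add: ucirc_def)

lemma continuous_on_ucirc [continuous_intros]: "continuous_on S ucirc"
  unfolding ucirc_def by (intro continuous_intros)

text \<open>Cauchy's formula for Taylor coefficients: \<open>du = 2 pi i u dt\<close> cancels one of
  the \<open>k + 1\<close> powers in the denominator and leaves a mean over the circle.\<close>

lemma coefficient_integral:
  fixes r R :: real
  assumes hol: "\<phi> holomorphic_on ball 0 R" and r: "0 < r" "r < R"
  shows "((\<lambda>t. \<phi> (r * ucirc t) / (r * ucirc t) ^ k) has_integral (deriv ^^ k) \<phi> 0 / fact k) {0..1}"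
proof -
  have "((\<lambda>u. \<phi> u / (u - 0) ^ Suc k) has_contour_integral ((2 * pi * \<i>) / (fact k) * (deriv ^^ k) \<phi> 0))
      (circlepath 0 r)"
    using hol r by (intro Cauchy_has_contour_integral_higher_derivative_circlepath)
      (auto intro!: holomorphic_on_imp_continuous_on elim!: holomorphic_on_subset)
  then have "((\<lambda>t. \<phi> (r * ucirc t) / (r * ucirc t) ^ Suc k * (2 * pi * \<i> * r * ucirc t))
      has_integral (2 * pi * \<i>) / (fact k) * (deriv ^^ k) \<phi> 0) {0..1}"
    unfolding has_contour_integral vector_derivative_circlepath
    by (simp add: circlepath ucirc_def mult.assoc)
  from has_integral_mult_right[OF this, of "1 / (2 * pi * \<i>)"]
  show ?thesis using r by (simp add: field_simps)
qed

text \<open>The Fourier coefficients on the opposite side vanish, since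
  \<open>\<phi> z * z ^ k\<close> is holomorphic and takes the value 0 at the origin.\<close>

lemma coefficient_integral_positive:
  fixes r R :: real
  assumes hol: "\<phi> holomorphic_on ball 0 R" and r: "0 < r" "r < R" and k: "0 < k"
  shows "((\<lambda>t. \<phi> (r * ucirc t) * (r * ucirc t) ^ k) has_integral 0) {0..1}"
proof -
  have "(\<lambda>z. \<phi> z * z ^ k) holomorphic_on ball 0 R" by (intro holomorphic_intros hol)
  from coefficient_integral[OF this r, of 0] show ?thesis using k by (simp add: power_0_left)
qed

section \<open>Derivatives along complex lines and the Cauchy mean formula\<close>

lemma fderiv_eq:
  assumes "(F has_derivative D) (at x)"
  shows "blinfun_apply (fderiv F x) = D"
  using frechet_derivative_at[OF assms] has_derivative_bounded_linear[OF assms]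
  by (simp add: fderiv_def bounded_linear_Blinfun_apply)

lemma holomorphic_on_ballD:
  assumes "holomorphic_on_ball F" "norm x < 1"
  shows "(F has_derivative fderiv F x) (at x)" "bounded_clinear (fderiv F x)"
  using assms fderiv_eq[of F] by (force simp: holomorphic_on_ball_def dist_norm)+

lemma bounded_clinear_diff:
  assumes "bounded_clinear f" shows "f (x - y) = f x - f y"
  using bounded_clinearD(1)[OF assms] by (simp add: bounded_linear.linear linear_diff)

lemma has_derivative_along:
  assumes D: "(G has_derivative D) (at (x + z *\<^sub>C h))" "bounded_clinear D"
  shows "((\<lambda>\<zeta>. G (x + \<zeta> *\<^sub>C h)) has_derivative (\<lambda>\<delta>. \<delta> *\<^sub>C D h)) (at z)"
proof -
  have "((\<lambda>\<zeta>. x + \<zeta> *\<^sub>C h) has_derivative (\<lambda>\<delta>. \<delta> *\<^sub>C h)) (at z)"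
    by (auto intro!: derivative_eq_intros bounded_linear_imp_has_derivative scaleC.bounded_linear_left)
  from has_derivative_compose[OF this D(1)] show ?thesis
    using bounded_clinearD(2)[OF D(2)] by simp
qed

lemma has_field_derivative_along:
  assumes D: "(G has_derivative D) (at (x + z *\<^sub>C h))" "bounded_clinear D" and T: "bounded_clinear T"
  shows "((\<lambda>\<zeta>. T (G (x + \<zeta> *\<^sub>C h)) :: complex) has_field_derivative T (D h)) (at z)"
  using bounded_linear.has_derivative[OF bounded_clinearD(1)[OF T] has_derivative_along[OF D]]
    bounded_clinearD(2)[OF T]
  by (simp add: has_field_derivative_def mult.commute[of _ "T (D h)"] fun_eq_iff cong: if_cong)

lemma norm_line_less:
  fixes x h :: "'a::complex_normed_vector"
  assumes "norm x + c * norm h < d" "cmod \<zeta> \<le> c"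
  shows "norm (x + \<zeta> *\<^sub>C h) < d"
  using norm_triangle_ineq[of x "\<zeta> *\<^sub>C h"] assms mult_right_mono[OF assms(2), of "norm h"]
  by (simp add: norm_scaleC)

text \<open>The vector-valued integral exists by continuity. Functionals \<open>T\<close> identify
  its value through the scalar Cauchy formula for the first coefficient of
  \<open>T (F (x + \<zeta> h))\<close>.\<close>

lemma Cauchy_mean:
  fixes F :: "'a::complex_normed_vector \<Rightarrow> 'b::complex_banach"
  assumes F: "holomorphic_on_ball F" and xh: "norm x + norm h < 1"
  shows "((\<lambda>t. (1 / ucirc t) *\<^sub>C F (x + ucirc t *\<^sub>C h)) has_integral fderiv F x h) {0..1}"
proof -
  have in_ball: "norm (x + ucirc t *\<^sub>C h) < 1" for t
    by (rule norm_line_less[of _ 1]) (use xh in auto)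
  have contF: "continuous_on (ball 0 1) F"
    using has_derivative_continuous[OF holomorphic_on_ballD(1)[OF F]]
    by (auto intro!: continuous_at_imp_continuous_on)
  have "continuous_on {0..1} (\<lambda>t. (1 / ucirc t) *\<^sub>C F (x + ucirc t *\<^sub>C h))"
    by (intro scaleC.continuous_on continuous_intros continuous_on_compose2[OF contF]) (use in_ball in auto)
  then obtain I where I: "((\<lambda>t. (1 / ucirc t) *\<^sub>C F (x + ucirc t *\<^sub>C h)) has_integral I) {0..1}"
    using integrable_continuous_real unfolding integrable_on_def by blast
  have "I = fderiv F x h"
  proof (rule clinear_functionals_separate)
    fix T :: "'b \<Rightarrow> complex" assume T: "bounded_clinear T"
    \<comment> \<open>The scalar formula on the unit circle needs holomorphy on a larger disc;
      \<open>R\<close> spends part of the slack \<open>1 - norm x - norm h\<close>.\<close>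
    obtain R where R: "R > 1" "norm x + R * norm h < 1"
    proof
      define e where "e = 1 - norm x - norm h"
      define q where "q = e / (2 * (norm h + 1))"
      have e: "e > 0" using xh by (simp add: e_def)
      then have "q * norm h \<le> e / 2"
        by (simp add: q_def divide_simps add_nonneg_pos)
      then have "q * norm h < e" using e by linarith
      then show "norm x + (1 + q) * norm h < 1" by (simp add: distrib_right e_def)
      show "1 + q > 1" using e by (simp add: q_def add_nonneg_pos)
    qed
    define \<phi> where "\<phi> \<zeta> = T (F (x + \<zeta> *\<^sub>C h))" for \<zeta>
    have d: "(\<phi> has_field_derivative T (fderiv F (x + z *\<^sub>C h) h)) (at z)" if "cmod z < R" for z
    proof -
      have "norm (x + z *\<^sub>C h) < 1" by (rule norm_line_less[OF R(2)]) (use that in simp)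
      then show ?thesis unfolding \<phi>_def
        by (intro has_field_derivative_along holomorphic_on_ballD F T)
    qed
    have "\<phi> holomorphic_on ball 0 R"
      unfolding holomorphic_on_def field_differentiable_def
      by (intro ballI exI) (rule has_field_derivative_at_within[OF d], simp)
    from coefficient_integral[OF this, of 1 1]
    have "((\<lambda>t. \<phi> (ucirc t) / ucirc t) has_integral deriv \<phi> 0) {0..1}"
      using R(1) by simp
    moreover have "deriv \<phi> 0 = T (fderiv F x h)"
      using DERIV_imp_deriv[OF d[of 0]] R(1) by simp
    moreover have "((\<lambda>t. \<phi> (ucirc t) / ucirc t) has_integral T I) {0..1}"
      using has_integral_linear[OF I bounded_clinearD(1)[OF T]]
      by (simp add: o_def bounded_clinearD(2)[OF T] \<phi>_def)
    ultimately show "T I = T (fderiv F x h)" by (metis has_integral_unique)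
  qed
  then show ?thesis using I by simp
qed

section \<open>Norm estimates for operator-valued derivatives\<close>

lemma has_integral_diff_bound:
  fixes f g :: "real \<Rightarrow> 'b::real_normed_vector"
  assumes "(f has_integral A) {0..1}" "(g has_integral B) {0..1}"
    and "\<And>t. norm (f t - g t) \<le> C"
  shows "norm (A - B) \<le> C"
proof -
  have "0 \<le> C" using norm_ge_zero assms(3) by (rule order_trans)
  from has_integral_bound[OF this has_integral_diff[OF assms(1,2), folded cbox_interval]] assms(3)
  show ?thesis by simp
qed

lemma norm_blinfun_le_sphere:
  fixes A :: "'a::real_normed_vector \<Rightarrow>\<^sub>L 'b::real_normed_vector"
  assumes r: "0 < r" and B: "0 \<le> B" and bound: "\<And>h. norm h = r \<Longrightarrow> norm (A h) \<le> B"
  shows "norm A \<le> B / r"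
proof (rule norm_blinfun_bound)
  show "0 \<le> B / r" using r B by simp
  fix h
  show "norm (A h) \<le> B / r * norm h"
  proof (cases "h = 0")
    case False
    have "norm (A ((r / norm h) *\<^sub>R h)) \<le> B"
      by (rule bound) (use False r in simp)
    then show ?thesis using False r by (simp add: blinfun.scaleR_right field_simps)
  qed (simp add: blinfun.zero_right)
qed

text \<open>Replacing \<open>k\<close> by \<open>s k\<close> and dividing by \<open>s > 0\<close>
  bounds \<open>norm (d k)\<close> by a multiple of \<open>s\<close>, which tends to 0.\<close>

lemma linear_quadratic_bound_zero:
  fixes d :: "'a::real_normed_vector \<Rightarrow> 'b::real_normed_vector"
  assumes d: "linear d" and r: "0 < r"
    and bound: "\<And>k. norm k < r \<Longrightarrow> norm (d k) \<le> N * (norm k)\<^sup>2"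
  shows "d k = 0"
proof -
  have "((\<lambda>s. s * norm k) \<longlongrightarrow> 0 * norm k) (at_right 0)" by (intro tendsto_intros)
  then have "eventually (\<lambda>s. s * norm k < r) (at_right 0)"
    using r by (intro order_tendstoD(2)) auto
  then have "eventually (\<lambda>s. norm (d k) \<le> s * (N * (norm k)\<^sup>2)) (at_right 0)"
    using eventually_at_right_less[of "0::real"]
  proof eventually_elim
    case (elim s)
    have "norm (d (s *\<^sub>R k)) \<le> N * (norm (s *\<^sub>R k))\<^sup>2"
      by (rule bound) (use elim in simp)
    then show ?case using elim by (simp add: linear_scale[OF d] power2_eq_square field_simps)
  qed
  moreover have "((\<lambda>s. s * (N * (norm k)\<^sup>2)) \<longlongrightarrow> 0 * (N * (norm k)\<^sup>2)) (at_right 0)"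
    by (intro tendsto_intros)
  ultimately have "norm (d k) \<le> 0 * (N * (norm k)\<^sup>2)"
    by (intro tendsto_lowerbound) auto
  then show ?thesis by simp
qed

text \<open>The factor \<open>norm h\<close> in the remainder makes pointwise differentiability
  uniform in \<open>h\<close>, hence valid in operator norm. Linearity of \<open>b\<close> in
  \<open>h\<close> is derived: since \<open>G (a + k) - G a\<close> is linear in \<open>h\<close>,
  the defect of linearity is of quadratic size in \<open>k\<close>, but it is linear in
  \<open>k\<close>, so it vanishes. This suits candidates \<open>b\<close> whose formula rescales
  \<open>h\<close>.\<close>

lemma has_derivative_blinfun_pointwise:
  fixes G :: "'a::real_normed_vector \<Rightarrow> 'c::real_normed_vector \<Rightarrow>\<^sub>L 'b::real_normed_vector"
  assumes lin: "\<And>h. linear (\<lambda>k. b k h)"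
    and bound: "\<And>k h. norm (b k h) \<le> C * norm k * norm h"
    and r: "0 < r" and K: "0 \<le> K" and C: "0 \<le> C"
    and est: "\<And>k h. norm k < r \<Longrightarrow> norm (G (a + k) h - G a h - b k h) \<le> K * norm h * (norm k)\<^sup>2"
  shows "\<exists>B. (G has_derivative B) (at a) \<and> (\<forall>k h. blinfun_apply (B k) h = b k h)"
proof -
  have add: "b k (h + h') = b k h + b k h'" for k h h'
  proof -
    have "b k (h + h') - b k h - b k h' = 0"
    proof (rule linear_quadratic_bound_zero[where d = "\<lambda>k. b k (h + h') - b k h - b k h'" and r = r])
      show "linear (\<lambda>k. b k (h + h') - b k h - b k h')"
        by (intro linear_compose_sub lin)
      fix k :: 'a assume k: "norm k < r"
      let ?e = "\<lambda>h. G (a + k) h - G a h - b k h"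
      \<comment> \<open>The values of \<open>G\<close> cancel, so the defect is a combination of
        three remainders.\<close>
      have "b k (h + h') - b k h - b k h' = ?e h + ?e h' - ?e (h + h')"
        by (simp add: blinfun.add_right)
      also have "norm \<dots> \<le> norm (?e h) + norm (?e h') + norm (?e (h + h'))"
        by (intro order_trans[OF norm_triangle_ineq4] add_mono norm_triangle_ineq order_refl)
      also have "\<dots> \<le> K * norm h * (norm k)\<^sup>2 + K * norm h' * (norm k)\<^sup>2 + K * norm (h + h') * (norm k)\<^sup>2"
        by (intro add_mono est k)
      finally show "norm (b k (h + h') - b k h - b k h')
          \<le> (K * norm h + K * norm h' + K * norm (h + h')) * (norm k)\<^sup>2"
        by (simp only: distrib_right)
    qed (rule r)
    then show ?thesis by (simp add: algebra_simps)
  qed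
  have scale: "b k (c *\<^sub>R h) = c *\<^sub>R b k h" for k h c
  proof -
    have "b k (c *\<^sub>R h) - c *\<^sub>R b k h = 0"
    proof (rule linear_quadratic_bound_zero[where d = "\<lambda>k. b k (c *\<^sub>R h) - c *\<^sub>R b k h" and r = r])
      show "linear (\<lambda>k. b k (c *\<^sub>R h) - c *\<^sub>R b k h)"
        by (intro linear_compose_sub linear_compose_scale_right lin)
      fix k :: 'a assume k: "norm k < r"
      let ?e = "\<lambda>h. G (a + k) h - G a h - b k h"
      have "b k (c *\<^sub>R h) - c *\<^sub>R b k h = c *\<^sub>R ?e h - ?e (c *\<^sub>R h)"
        by (simp add: blinfun.scaleR_right algebra_simps)
      also have "norm \<dots> \<le> \<bar>c\<bar> * norm (?e h) + norm (?e (c *\<^sub>R h))"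
        by (intro order_trans[OF norm_triangle_ineq4]) simp
      also have "\<dots> \<le> \<bar>c\<bar> * (K * norm h * (norm k)\<^sup>2) + K * norm (c *\<^sub>R h) * (norm k)\<^sup>2"
        by (intro add_mono mult_left_mono est k) auto
      finally show "norm (b k (c *\<^sub>R h) - c *\<^sub>R b k h)
          \<le> (\<bar>c\<bar> * (K * norm h) + K * norm (c *\<^sub>R h)) * (norm k)\<^sup>2"
        by (simp add: algebra_simps)
    qed (rule r)
    then show ?thesis by simp
  qed
  have bl: "bounded_linear (b k)" for k
    by (rule bounded_linear_intro[of _ "C * norm k"]) (use add scale bound in \<open>auto simp: mult_ac\<close>)
  define B where "B k = Blinfun (b k)" for k
  have B: "blinfun_apply (B k) h = b k h" for k h
    by (simp add: B_def bounded_linear_Blinfun_apply[OF bl])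
  have "bounded_linear B"
  proof (rule bounded_linear_intro[of _ C])
    show "B (x + y) = B x + B y" for x y
      by (rule blinfun_eqI) (simp add: B plus_blinfun.rep_eq linear_add[OF lin])
    show "B (c *\<^sub>R x) = c *\<^sub>R B x" for c x
      by (rule blinfun_eqI) (simp add: B scaleR_blinfun.rep_eq linear_scale[OF lin])
    show "norm (B x) \<le> norm x * C" for x
      by (rule norm_blinfun_bound) (use C bound[of x] in \<open>auto simp: B mult_ac\<close>)
  qed
  then have "(G has_derivative B) (at a)"
  proof (rule has_derivativeI_sandwich[OF r, where H = "\<lambda>y. K * norm (y - a)"])
    fix y assume y: "y \<noteq> a" "dist y a < r"
    have "norm (G y - G a - B (y - a)) \<le> K * (norm (y - a))\<^sup>2"
      by (rule norm_blinfun_bound)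
        (use K y est[of "y - a"] in \<open>auto simp: blinfun.diff_left B dist_norm mult_ac\<close>)
    then show "norm ((G y - G a) - B (y - a)) / norm (y - a) \<le> K * norm (y - a)"
      using y by (simp add: divide_simps power2_eq_square mult_ac)
  next
    show "((\<lambda>y. K * norm (y - a)) \<longlongrightarrow> 0) (at a)"
      by (auto intro!: tendsto_eq_intros)
  qed
  then show ?thesis using B by blast
qed

text \<open>Continuity makes \<open>F\<close> locally bounded; the Cauchy formula then bounds
  \<open>D\<close>, which makes \<open>F\<close> Lipschitz, hence \<open>D\<close> Lipschitz, hence
  the Taylor remainder of \<open>F\<close> quadratic. With that remainder the Cauchy formula can be
  differentiated under the integral sign.\<close>

lemma holomorphic_on_ball_fderiv:
  fixes F :: "'a::complex_normed_vector \<Rightarrow> 'b::complex_banach"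
  assumes F: "holomorphic_on_ball F"
  shows "holomorphic_on_ball (fderiv F)"
  unfolding holomorphic_on_ball_def
proof
  fix a :: 'a assume "a \<in> ball 0 1"
  then have a: "norm a < 1" by simp
  have "isCont F a" by (rule has_derivative_continuous[OF holomorphic_on_ballD(1)[OF F a]])
  then obtain \<delta>0 where \<delta>0: "\<delta>0 > 0" "\<And>x. norm (x - a) < \<delta>0 \<Longrightarrow> norm (F x - F a) < 1"
    unfolding continuous_at_eps_delta dist_norm by (meson zero_less_one)
  \<comment> \<open>Each use of the Cauchy formula moves the base point by up to \<open>r\<close>:
    \<open>F\<close> is bounded within \<open>4 r\<close> of \<open>a\<close>, \<open>D\<close>
    within \<open>3 r\<close>, and \<open>D\<close> is Lipschitz within \<open>2 r\<close>.\<close>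
  define r where "r = min \<delta>0 (1 - norm a) / 4"
  define M where "M = 1 + norm (F a)"
  have r: "r > 0" "4 * r \<le> \<delta>0" "norm a + 4 * r \<le> 1" using \<delta>0(1) a by (auto simp: r_def)
  have M: "norm (F x) \<le> M" if "norm (x - a) < 4 * r" for x
    using \<delta>0(2)[of x] norm_triangle_ineq2[of "F x" "F a"] that r by (auto simp: M_def)
  have M0: "0 \<le> M" by (simp add: M_def)
  have small: "norm x < 1" if "norm (x - a) < 4 * r" for x
    using norm_triangle_sub[of x a] that r by simp
  have shift: "norm (x + ucirc t *\<^sub>C h - a) < s + r" if "norm (x - a) < s" "norm h \<le> r" for x h t s
    using norm_triangle_ineq[of "x - a" "ucirc t *\<^sub>C h"] that
    by (simp add: norm_scaleC algebra_simps)
  have dom: "norm x + norm h < 1" if "norm (x - a) < 3 * r" "norm h \<le> r" for x h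
    using norm_triangle_sub[of x a] that r by simp
  define D where "D = fderiv F"
  define L where "L = M / r"
  define K where "K = L / r"
  have L0: "0 \<le> L" and K0: "0 \<le> K" using M0 r by (auto simp: L_def K_def)
  have derF: "(F has_derivative D x) (at x)" "bounded_clinear (D x)" if "norm (x - a) < 4 * r" for x
    using holomorphic_on_ballD[OF F small[OF that]] by (auto simp: D_def)
  have mean: "((\<lambda>t. (1 / ucirc t) *\<^sub>C F (x + ucirc t *\<^sub>C h)) has_integral D x h) {0..1}"
    if "norm (x - a) < 3 * r" "norm h \<le> r" for x h
    unfolding D_def by (rule Cauchy_mean[OF F dom[OF that]])
  have D_bound: "norm (D x) \<le> L" if x: "norm (x - a) < 3 * r" for x
    unfolding L_def
  proof (rule norm_blinfun_le_sphere[OF r(1) M0])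
    fix h :: 'a assume h: "norm h = r"
    have "norm (D x h - 0) \<le> M"
      by (rule has_integral_diff_bound[OF mean[OF x] has_integral_0])
        (use h shift[OF x] M in \<open>auto simp: norm_scaleC norm_divide\<close>)
    then show "norm (D x h) \<le> M" by simp
  qed
  have F_lip: "norm (F x - F y) \<le> L * norm (x - y)"
    if "norm (x - a) < 3 * r" "norm (y - a) < 3 * r" for x y
  proof (rule differentiable_bound[of "ball a (3 * r)" F "\<lambda>x. D x"])
    fix x assume "x \<in> ball a (3 * r)"
    then have x: "norm (x - a) < 3 * r" by (simp add: dist_norm norm_minus_commute)
    then show "(F has_derivative D x) (at x within ball a (3 * r))"
      using derF[of x] r by (auto intro: has_derivative_at_withinI)
    show "onorm (D x) \<le> L" using D_bound[OF x] by (simp add: norm_blinfun.rep_eq)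
  qed (use that in \<open>auto simp: dist_norm norm_minus_commute\<close>)
  have D_lip: "norm (D x - D y) \<le> K * norm (x - y)"
    if x: "norm (x - a) < 2 * r" and y: "norm (y - a) < 2 * r" for x y
  proof -
    have "norm (D x - D y) \<le> (L * norm (x - y)) / r"
    proof (rule norm_blinfun_le_sphere[OF r(1)])
      fix h :: 'a assume h: "norm h = r"
      have "norm (D x h - D y h) \<le> L * norm (x - y)"
      proof (rule has_integral_diff_bound[OF mean mean])
        show "norm ((1 / ucirc t) *\<^sub>C F (x + ucirc t *\<^sub>C h) - (1 / ucirc t) *\<^sub>C F (y + ucirc t *\<^sub>C h))
            \<le> L * norm (x - y)" for t
          using F_lip[of "x + ucirc t *\<^sub>C h" "y + ucirc t *\<^sub>C h"] shift[OF x] shift[OF y] h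
          by (simp add: scaleC.diff_right[symmetric] norm_scaleC norm_divide)
      qed (use x y r h in auto)
      then show "norm ((D x - D y) h) \<le> L * norm (x - y)" by (simp add: blinfun.diff_left)
    qed (use L0 in simp)
    then show ?thesis by (simp add: K_def)
  qed
  have taylor: "norm (F (x + k) - F x - D x k) \<le> K * (norm k)\<^sup>2"
    if x: "norm (x - a) < 2 * r" and xk: "norm (x + k - a) < 2 * r" for x k
  proof -
    \<comment> \<open>This set is convex, contains the segment from \<open>x\<close> to
      \<open>x + k\<close>, and \<open>D\<close> differs from \<open>D x\<close> on it by at most
      \<open>K * norm k\<close>.\<close>
    define S where "S = ball a (2 * r) \<inter> cball x (norm k)"
    have S: "norm (y - a) < 2 * r" "norm (y - x) \<le> norm k" if "y \<in> S" for y
      using that by (auto simp: S_def dist_norm norm_minus_commute)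
    have "norm (F (x + k) - F x - D x ((x + k) - x)) \<le> norm ((x + k) - x) * (K * norm k)"
    proof (rule differentiable_bound_linearization[where S = S and f' = "\<lambda>x. D x"])
      have "convex S" by (auto simp: S_def convex_Int)
      moreover have "x \<in> S" "x + k \<in> S"
        using x xk by (auto simp: S_def dist_norm norm_minus_commute diff_diff_eq2)
      ultimately show "x + t *\<^sub>R (x + k - x) \<in> S" if "t \<in> {0..1}" for t
        using convexD_alt[of S x "x + k" t] that by (simp add: algebra_simps)
      show "x \<in> S" by fact
      fix y assume y: "y \<in> S"
      show "(F has_derivative D y) (at y within S)"
        using derF[of y] S[OF y] r by (auto intro: has_derivative_at_withinI)
      have "norm (D y - D x) \<le> K * norm k"
        using D_lip[OF S(1)[OF y] x] S(2)[OF y] K0 by (meson mult_left_mono order_trans)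
      then show "onorm (blinfun_apply (D y) - blinfun_apply (D x)) \<le> K * norm k"
        by (simp add: norm_blinfun.rep_eq minus_blinfun.rep_eq fun_diff_def)
    qed
    then show ?thesis by (simp add: power2_eq_square mult_ac)
  qed
  \<comment> \<open>The mean formula needs directions of length at most \<open>r\<close>, so
    \<open>h\<close> is rescaled to length \<open>r\<close> and \<open>b\<close> undoes the factor.
    For \<open>h = 0\<close> division by zero gives \<open>\<rho> h = 0\<close>, which respects the
    bound.\<close>
  define \<rho> where "\<rho> h = r / norm h" for h :: 'a
  have \<rho>: "norm (\<rho> h *\<^sub>R h) \<le> r" for h using r by (simp add: \<rho>_def)
  \<comment> \<open>The candidate for the second derivative: the mean formula for
    \<open>D a h\<close>, differentiated under the integral in the direction
    \<open>k\<close>.\<close>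
  define b where "b k h = (norm h / r) *\<^sub>R
      integral {0..1} (\<lambda>t. (1 / ucirc t) *\<^sub>C D (a + ucirc t *\<^sub>C \<rho> h *\<^sub>R h) k)" for k h
  have near: "norm (a + ucirc t *\<^sub>C \<rho> h *\<^sub>R h - a) \<le> r" for t h
    using \<rho>[of h] by (simp add: norm_scaleC)
  have "K-lipschitz_on (ball a (2 * r)) D"
    by (rule lipschitz_onI) (simp_all add: dist_norm D_lip K0 norm_minus_commute[of a])
  then have contD: "continuous_on (ball a (2 * r)) D"
    by (rule lipschitz_on_continuous_on)
  have "continuous_on {0..1} (\<lambda>t. D (a + ucirc t *\<^sub>C \<rho> h *\<^sub>R h))" for h
  proof (rule continuous_on_compose2[OF contD])
    show "continuous_on {0..1} (\<lambda>t. a + ucirc t *\<^sub>C \<rho> h *\<^sub>R h)"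
      by (intro scaleC.continuous_on continuous_intros)
    show "(\<lambda>t. a + ucirc t *\<^sub>C \<rho> h *\<^sub>R h) ` {0..1} \<subseteq> ball a (2 * r)"
      using near[of _ h] r(1) by (auto simp: dist_norm norm_scaleC)
  qed
  then have "continuous_on {0..1} (\<lambda>t. (1 / ucirc t) *\<^sub>C D (a + ucirc t *\<^sub>C \<rho> h *\<^sub>R h) k)" for k h
    by (intro scaleC.continuous_on blinfun.continuous_on continuous_intros) auto
  then have int: "((\<lambda>t. (1 / ucirc t) *\<^sub>C D (a + ucirc t *\<^sub>C \<rho> h *\<^sub>R h) k) has_integral
      integral {0..1} (\<lambda>t. (1 / ucirc t) *\<^sub>C D (a + ucirc t *\<^sub>C \<rho> h *\<^sub>R h) k)) {0..1}" for k h
    by (intro integrable_integral integrable_continuous_real)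
  have lin: "linear (\<lambda>k. b k h)" for h
  proof (rule linearI)
    fix k k' :: 'a and c :: real
    show "b (k + k') h = b k h + b k' h"
      using integral_unique[OF has_integral_add[OF int[of h k] int[of h k']]]
      by (simp add: b_def blinfun.add_right scaleC_add_right scaleR_add_right)
    show "b (c *\<^sub>R k) h = c *\<^sub>R b k h"
      using integral_unique[OF has_integral_cmul[OF int[of h k], of c]]
      by (simp add: b_def blinfun.scaleR_right scaleC.scaleR_right)
  qed
  have clin: "b (c *\<^sub>C k) h = c *\<^sub>C b k h" for c k h
  proof -
    have "D (a + ucirc t *\<^sub>C \<rho> h *\<^sub>R h) (c *\<^sub>C k) = c *\<^sub>C D (a + ucirc t *\<^sub>C \<rho> h *\<^sub>R h) k" for t
      using bounded_clinearD(2)[OF derF(2)] near[of t h] r by simp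
    then show ?thesis
      using integral_unique[OF has_integral_linear[OF int[of h k] scaleC.bounded_linear_right[of c]]]
      by (simp add: b_def o_def scaleC.scaleR_right scaleC_scaleC mult.commute)
  qed
  have bound: "norm (b k h) \<le> K * norm k * norm h" for k h
  proof -
    have "norm (integral {0..1} (\<lambda>t. (1 / ucirc t) *\<^sub>C D (a + ucirc t *\<^sub>C \<rho> h *\<^sub>R h) k) - 0) \<le> L * norm k"
    proof (rule has_integral_diff_bound[OF int has_integral_0])
      fix t
      have "norm (D (a + ucirc t *\<^sub>C \<rho> h *\<^sub>R h)) \<le> L"
        by (rule D_bound) (use near[of t h] r in simp)
      then have "norm (D (a + ucirc t *\<^sub>C \<rho> h *\<^sub>R h) k) \<le> L * norm k"
        by (rule order_trans[OF norm_blinfun mult_right_mono]) simp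
      then show "norm ((1 / ucirc t) *\<^sub>C D (a + ucirc t *\<^sub>C \<rho> h *\<^sub>R h) k - 0) \<le> L * norm k"
        by (simp add: norm_scaleC norm_divide)
    qed
    from mult_left_mono[OF this, of "norm h / r"] show ?thesis
      using r by (simp add: b_def K_def mult_ac)
  qed
  have est: "norm (D (a + k) h - D a h - b k h) \<le> (K / r) * norm h * (norm k)\<^sup>2" if k: "norm k < r" for k h
  proof (cases "h = 0")
    case True then show ?thesis by (simp add: b_def blinfun.zero_right)
  next
    case False
    define h' where "h' = \<rho> h *\<^sub>R h"
    have h': "norm h' \<le> r" "(norm h / r) *\<^sub>R h' = h"
      using \<rho>[of h] False r by (auto simp: h'_def \<rho>_def)
    define I where "I = integral {0..1} (\<lambda>t. (1 / ucirc t) *\<^sub>C D (a + ucirc t *\<^sub>C h') k)"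
    \<comment> \<open>The three integrals combine to the mean of the Taylor remainder of
      \<open>F\<close> over the circle around \<open>a\<close>.\<close>
    have "norm ((D (a + k) h' - D a h') - I) \<le> K * (norm k)\<^sup>2"
    proof (rule has_integral_diff_bound[OF has_integral_diff[OF mean mean] int[of h k, folded h'_def, folded I_def]])
      fix t
      define x where "x = a + ucirc t *\<^sub>C h'"
      have "norm (F (x + k) - F x - D x k) \<le> K * (norm k)\<^sup>2"
      proof (rule taylor)
        show "norm (x - a) < 2 * r"
          using shift[of a r h' t] h'(1) r(1) unfolding x_def by simp
        have "norm (a + k + ucirc t *\<^sub>C h' - a) < r + r"
          by (rule shift) (use k h'(1) in simp_all)
        moreover have "x + k - a = a + k + ucirc t *\<^sub>C h' - a"
          by (simp add: x_def add_ac)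
        ultimately show "norm (x + k - a) < 2 * r" by (simp only: mult_2)
      qed
      moreover have "(1 / ucirc t) *\<^sub>C F (a + k + ucirc t *\<^sub>C h') - (1 / ucirc t) *\<^sub>C F (a + ucirc t *\<^sub>C h')
          - (1 / ucirc t) *\<^sub>C D (a + ucirc t *\<^sub>C h') k = (1 / ucirc t) *\<^sub>C (F (x + k) - F x - D x k)"
        by (simp add: x_def scaleC.diff_right add_ac)
      ultimately show "norm ((1 / ucirc t) *\<^sub>C F (a + k + ucirc t *\<^sub>C h') - (1 / ucirc t) *\<^sub>C F (a + ucirc t *\<^sub>C h')
          - (1 / ucirc t) *\<^sub>C D (a + ucirc t *\<^sub>C h') k) \<le> K * (norm k)\<^sup>2"
        by (simp add: norm_scaleC norm_divide)
    qed (use k h'(1) r(1) in auto)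
    from mult_left_mono[OF this, of "norm h / r"]
    have "norm ((norm h / r) *\<^sub>R ((D (a + k) h' - D a h') - I)) \<le> norm h / r * (K * (norm k)\<^sup>2)"
      using r by simp
    also have "(norm h / r) *\<^sub>R ((D (a + k) h' - D a h') - I)
        = D (a + k) ((norm h / r) *\<^sub>R h') - D a ((norm h / r) *\<^sub>R h') - b k h"
      by (simp only: b_def I_def h'_def scaleR_diff_right blinfun.scaleR_right)
    finally show ?thesis unfolding h'(2) by (simp add: mult_ac)
  qed
  have Kr: "0 \<le> K / r" using K0 r(1) by simp
  obtain B where B: "(D has_derivative B) (at a)" "\<And>k h. blinfun_apply (B k) h = b k h"
    using has_derivative_blinfun_pointwise[OF lin bound r(1) Kr K0 est] by blast
  \<comment> \<open>Complex linearity of the new derivative is what allows the lemma to be applied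
    again to \<open>fderiv F\<close>.\<close>
  have "B (c *\<^sub>C k) = c *\<^sub>C B k" for c k
    by (rule blinfun_eqI) (simp add: B scaleC_blinfun.rep_eq clin)
  then show "\<exists>B. bounded_clinear B \<and> (fderiv F has_derivative B) (at a)"
    using B(1) has_derivative_bounded_linear[OF B(1)]
    by (auto simp: bounded_clinear_def D_def)
qed

section \<open>Functions with real part bounded below\<close>

lemma Re_cube: "Re (w ^ 3) = Re w ^ 3 - 3 * Re w * (Im w)\<^sup>2"
  by (simp add: power3_eq_cube power2_eq_square algebra_simps)

text \<open>With \<open>c = cos \<theta>\<close> the tested polynomial is
  \<open>A + k cos \<theta> + l cos 3\<theta>\<close>, rotated by \<open>\<omega>\<close>. Its
  product with \<open>Re p - \<alpha>\<close> has nonnegative mean over the circle of radius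
  \<open>r\<close>, and only the coefficients of \<open>p\<close> of orders 0, 1 and 3 survive in
  that mean.\<close>

lemma trig_test_inequality_circle:
  fixes r A k l \<alpha> :: real
  assumes hol: "p holomorphic_on ball 0 1" and p0: "p 0 = 1"
    and Re_p: "\<And>z. cmod z < 1 \<Longrightarrow> \<alpha> < Re (p z)"
    and nonneg: "\<And>c. \<bar>c\<bar> \<le> 1 \<Longrightarrow> 0 \<le> A + k * c + l * (4 * c ^ 3 - 3 * c)"
    and \<omega>: "cmod \<omega> = 1" and r: "0 < r" "r < 1"
  shows "0 \<le> A * (1 - \<alpha>) + k / 2 * r * Re (\<omega> * deriv p 0) + l / 2 * r ^ 3 * Re (\<omega> ^ 3 * ((deriv ^^ 3) p 0 / 6))"
proof -
  define f where "f t = p (r * ucirc t)" for t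
  \<comment> \<open>\<open>v\<close> is the conjugate of \<open>ucirc\<close>, written as an inverse
    to match the denominators in \<open>coefficient_integral\<close>.\<close>
  define v where "v t = inverse (ucirc t)" for t
  define c1 where "c1 = deriv p 0"
  define c3 where "c3 = (deriv ^^ 3) p 0 / 6"
  define L where "L t = A + k / 2 * (\<omega> * v t + cnj \<omega> * ucirc t)
      + l / 2 * (\<omega> ^ 3 * v t ^ 3 + cnj \<omega> ^ 3 * ucirc t ^ 3)" for t
  have neg: "((\<lambda>t. f t * v t ^ n) has_integral (r ^ n * ((deriv ^^ n) p 0 / fact n))) {0..1}" for n
    using has_integral_mult_right[OF coefficient_integral[OF hol r, of n], of "of_real r ^ n"] r(1)
    by (simp add: f_def v_def power_mult_distrib field_simps)
  have n0: "(f has_integral 1) {0..1}" using neg[of 0] p0 by simp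
  have n1: "((\<lambda>t. f t * v t) has_integral r * c1) {0..1}" using neg[of 1] by (simp add: c1_def)
  have n3: "((\<lambda>t. f t * v t ^ 3) has_integral r ^ 3 * c3) {0..1}"
    using neg[of 3] by (simp add: c3_def fact_numeral)
  have pos: "((\<lambda>t. f t * ucirc t ^ n) has_integral 0) {0..1}" if "0 < n" for n
    using has_integral_mult_right[OF coefficient_integral_positive[OF hol r that], of "1 / of_real r ^ n"] r(1)
    by (simp add: f_def power_mult_distrib field_simps)
  \<comment> \<open>These moments of the constant 1 treat the term \<open>- \<alpha>\<close>, for
    which only \<open>A\<close> survives.\<close>
  have one: "((\<lambda>t. v t ^ n) has_integral 0) {0..1}" "((\<lambda>t. ucirc t ^ n) has_integral 0) {0..1}"
    if "0 < n" for n
  proof -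
    have c: "(\<lambda>_::complex. 1::complex) holomorphic_on ball 0 2" by simp
    have "(deriv ^^ n) (\<lambda>_::complex. 1::complex) 0 = 0"
      using that by (simp add: higher_deriv_const)
    then show "((\<lambda>t. v t ^ n) has_integral 0) {0..1}"
      using coefficient_integral[OF c, of 1 n] by (simp add: v_def field_simps)
    show "((\<lambda>t. ucirc t ^ n) has_integral 0) {0..1}"
      using coefficient_integral_positive[OF c, of 1 n] that by simp
  qed
  have fL: "((\<lambda>t. A * f t + k / 2 * (\<omega> * (f t * v t) + cnj \<omega> * (f t * ucirc t ^ 1))
        + l / 2 * (\<omega> ^ 3 * (f t * v t ^ 3) + cnj \<omega> ^ 3 * (f t * ucirc t ^ 3))) has_integral
       (complex_of_real A * 1 + k / 2 * (\<omega> * (r * c1) + cnj \<omega> * 0)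
        + l / 2 * (\<omega> ^ 3 * (r ^ 3 * c3) + cnj \<omega> ^ 3 * 0))) {0..1}"
    using pos[of 1] pos[of 3]
    by (intro has_integral_add[OF has_integral_add[OF has_integral_mult_right[OF n0]]]
        has_integral_add has_integral_mult_right n1 n3) simp_all
  have const: "((\<lambda>_::real. 1::complex) has_integral 1) {0..1}"
    using has_integral_const_real[of "1::complex" 0 1] by simp
  have "((\<lambda>t. \<alpha> * (complex_of_real A * 1 + k / 2 * (\<omega> * (v t ^ 1) + cnj \<omega> * (ucirc t ^ 1))
        + l / 2 * (\<omega> ^ 3 * (v t ^ 3) + cnj \<omega> ^ 3 * (ucirc t ^ 3)))) has_integral
       \<alpha> * (complex_of_real A * 1 + k / 2 * (\<omega> * 0 + cnj \<omega> * 0) + l / 2 * (\<omega> ^ 3 * 0 + cnj \<omega> ^ 3 * 0))) {0..1}"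
    by (intro has_integral_mult_right[OF has_integral_add[OF has_integral_add[OF has_integral_mult_right[OF const]]]]
        has_integral_add has_integral_mult_right one) simp_all
  note diff = has_integral_diff[OF fL this]
  define I where "I = A * (1 - \<alpha>) + k / 2 * (\<omega> * (r * c1)) + l / 2 * (\<omega> ^ 3 * (r ^ 3 * c3))"
  have pointwise: "A * f t + k / 2 * (\<omega> * (f t * v t) + cnj \<omega> * (f t * ucirc t ^ 1))
        + l / 2 * (\<omega> ^ 3 * (f t * v t ^ 3) + cnj \<omega> ^ 3 * (f t * ucirc t ^ 3))
      - \<alpha> * (complex_of_real A * 1 + k / 2 * (\<omega> * (v t ^ 1) + cnj \<omega> * (ucirc t ^ 1))
        + l / 2 * (\<omega> ^ 3 * (v t ^ 3) + cnj \<omega> ^ 3 * (ucirc t ^ 3))) = (f t - \<alpha>) * L t" for t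
    by (simp add: L_def algebra_simps del: of_real_divide)
  have "complex_of_real A * 1 + k / 2 * (\<omega> * (r * c1) + cnj \<omega> * 0) + l / 2 * (\<omega> ^ 3 * (r ^ 3 * c3) + cnj \<omega> ^ 3 * 0)
       - \<alpha> * (complex_of_real A * 1 + k / 2 * (\<omega> * 0 + cnj \<omega> * 0) + l / 2 * (\<omega> ^ 3 * 0 + cnj \<omega> ^ 3 * 0)) = I"
    by (simp add: I_def algebra_simps)
  from has_integral_eq_rhs[OF diff this[symmetric]] have "((\<lambda>t. (f t - \<alpha>) * L t) has_integral I) {0..1}"
    by (simp only: pointwise)
  from has_integral_linear[OF this bounded_linear_Re]
  have int: "((\<lambda>t. Re ((f t - \<alpha>) * L t)) has_integral Re I) {0..1}" by (simp add: o_def)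
  have "0 \<le> Re ((f t - \<alpha>) * L t)" for t
  proof -
    define w where "w = \<omega> * v t"
    have w: "cmod w = 1" using \<omega> by (simp add: w_def v_def norm_mult norm_inverse)
    have "ucirc t * cnj (ucirc t) = 1" using complex_norm_square[of "ucirc t"] by simp
    then have "cnj (v t) = ucirc t" by (simp add: v_def divide_simps mult.commute)
    then have "L t = A + k / 2 * (w + cnj w) + l / 2 * (w ^ 3 + cnj (w ^ 3))"
      by (simp add: L_def power_mult_distrib w_def)
    then have L: "L t = complex_of_real (A + k * Re w + l * Re (w ^ 3))"
      by (simp only: complex_add_cnj) simp
    \<comment> \<open>On the unit circle \<open>Re (w ^ 3)\<close> is the Chebyshev polynomial
      \<open>4 c^3 - 3 c\<close> of \<open>c = Re w\<close>.\<close>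
    have "(Im w)\<^sup>2 = 1 - (Re w)\<^sup>2" using w cmod_power2[of w] by simp
    then have "Re (w ^ 3) = Re w ^ 3 - 3 * Re w * (1 - (Re w)\<^sup>2)"
      by (simp only: Re_cube)
    then have "Re (w ^ 3) = 4 * Re w ^ 3 - 3 * Re w"
      by (simp add: power3_eq_cube power2_eq_square algebra_simps)
    then have "0 \<le> A + k * Re w + l * Re (w ^ 3)"
      using nonneg[of "Re w"] abs_Re_le_cmod[of w] w by simp
    moreover have "\<alpha> < Re (f t)" unfolding f_def
      by (rule Re_p) (use r in \<open>simp add: norm_mult\<close>)
    ultimately show ?thesis unfolding L by simp
  qed
  then have "0 \<le> Re I" by (rule has_integral_nonneg[OF int])
  moreover have "I = complex_of_real (A * (1 - \<alpha>)) + complex_of_real (k / 2 * r) * (\<omega> * c1)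
      + complex_of_real (l / 2 * r ^ 3) * (\<omega> ^ 3 * c3)"
    by (simp add: I_def mult_ac)
  ultimately show ?thesis
    by (simp add: c1_def c3_def del: of_real_mult of_real_divide of_real_power)
qed

text \<open>The powers of \<open>r\<close> disappear in the limit as \<open>r\<close> tends to 1
  from below.\<close>

lemma trig_test_inequality:
  fixes A k l \<alpha> :: real
  assumes "p holomorphic_on ball 0 1" "p 0 = 1"
    and "\<And>z. cmod z < 1 \<Longrightarrow> \<alpha> < Re (p z)"
    and "\<And>c. \<bar>c\<bar> \<le> 1 \<Longrightarrow> 0 \<le> A + k * c + l * (4 * c ^ 3 - 3 * c)"
    and "cmod \<omega> = 1"
  shows "0 \<le> A * (1 - \<alpha>) + k / 2 * Re (\<omega> * deriv p 0) + l / 2 * Re (\<omega> ^ 3 * ((deriv ^^ 3) p 0 / 6))"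
proof -
  let ?g = "\<lambda>r. A * (1 - \<alpha>) + k / 2 * r * Re (\<omega> * deriv p 0)
      + l / 2 * r ^ 3 * Re (\<omega> ^ 3 * ((deriv ^^ 3) p 0 / 6))"
  have "(?g \<longlongrightarrow> ?g 1) (at_left 1)" by (intro tendsto_intros)
  moreover have "eventually (\<lambda>r. 0 \<le> ?g r) (at_left (1::real))"
    using eventually_at_left_real[OF zero_less_one]
    by (rule eventually_mono) (use trig_test_inequality_circle[OF assms] in auto)
  ultimately have "0 \<le> ?g 1" by (rule tendsto_lowerbound) simp
  then show ?thesis by simp
qed

text \<open>With \<open>\<lambda> = 4 - 4 \<beta>^2\<close>, the cubic
  \<open>3 t - \<lambda> t^3\<close> increases on \<open>[0, 1]\<close> if
  \<open>\<lambda> <= 1\<close>; otherwise its maximum is at \<open>t = 1 / sqrt \<lambda>\<close>.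
  This is the case distinction in \<open>J23_bound\<close>.\<close>

lemma extremal_cubic_bound:
  fixes t \<beta> :: real
  assumes t: "0 \<le> t" "t \<le> 1" and \<beta>: "0 < \<beta>" "\<beta> \<le> 1"
  shows "2 * \<beta> * (3 * t - (4 - 4 * \<beta>\<^sup>2) * t ^ 3) \<le> 3 * J23_bound (1 - \<beta>)"
proof (cases "sqrt 3 / 2 \<le> \<beta>")
  case True
  then have "(sqrt 3 / 2)\<^sup>2 \<le> \<beta>\<^sup>2" by (intro power_mono) auto
  then have \<lambda>: "3 \<le> 4 * \<beta>\<^sup>2" by (simp add: power_divide)
  have t3: "t ^ 3 \<le> 1" using t by (simp add: power_le_one)
  \<comment> \<open>The product is \<open>t^3 - 3 t + 2\<close>, with a double zero at the maximiser
    of \<open>3 t - t^3\<close>.\<close>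
  have "0 \<le> (t - 1)\<^sup>2 * (t + 2)" using t by simp
  then have "3 * t - t ^ 3 \<le> 2" by (simp add: power2_eq_square power3_eq_cube algebra_simps)
  moreover have "(4 * \<beta>\<^sup>2 - 3) * t ^ 3 \<le> (4 * \<beta>\<^sup>2 - 3) * 1"
    using \<lambda> t3 by (intro mult_left_mono) auto
  ultimately have "3 * t - (4 - 4 * \<beta>\<^sup>2) * t ^ 3 \<le> 4 * \<beta>\<^sup>2 - 1"
    by (simp add: algebra_simps)
  then have "2 * \<beta> * (3 * t - (4 - 4 * \<beta>\<^sup>2) * t ^ 3) \<le> 2 * \<beta> * (4 * \<beta>\<^sup>2 - 1)"
    using \<beta> by (intro mult_left_mono) auto
  then show ?thesis using True by (simp add: J23_bound_def)
next
  case False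
  then have "\<beta>\<^sup>2 < (sqrt 3 / 2)\<^sup>2" using \<beta> by (intro power_strict_mono) auto
  then have lt: "\<beta>\<^sup>2 < 1" by (simp add: power_divide)
  define q where "q = sqrt (1 - \<beta>\<^sup>2)"
  have q: "q > 0" "q\<^sup>2 = 1 - \<beta>\<^sup>2" using lt by (auto simp: q_def)
  \<comment> \<open>The same identity in the variable \<open>2 * q * t\<close>, with its double zero
    at \<open>t = 1 / (2 * q)\<close>.\<close>
  have "0 \<le> (2 * q * t - 1)\<^sup>2 * (2 * q * t + 2)" using q t by simp
  then have "3 * t * q - 4 * q\<^sup>2 * q * t ^ 3 \<le> 1"
    by (simp add: power2_eq_square power3_eq_cube algebra_simps)
  then have "(3 * t - 4 * q\<^sup>2 * t ^ 3) * q \<le> 1" by (simp add: algebra_simps)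
  moreover have "4 - 4 * \<beta>\<^sup>2 = 4 * q\<^sup>2" using q(2) by simp
  ultimately have "3 * t - (4 - 4 * \<beta>\<^sup>2) * t ^ 3 \<le> 1 / q"
    using q(1) by (simp add: pos_le_divide_eq)
  then have "2 * \<beta> * (3 * t - (4 - 4 * \<beta>\<^sup>2) * t ^ 3) \<le> 2 * \<beta> * (1 / q)"
    using \<beta> by (intro mult_left_mono) auto
  then show ?thesis using False by (simp add: J23_bound_def q_def)
qed

text \<open>The maximiser is 1 in the first case and \<open>1 / (2 * q)\<close> in the second, where
  \<open>q >= 1 / 2\<close> keeps it in \<open>[0, 1]\<close>.\<close>

lemma extremal_cubic_attained:
  fixes \<beta> :: real
  assumes \<beta>: "0 < \<beta>" "\<beta> \<le> 1"
  obtains t where "0 \<le> t" "t \<le> 1" "2 * \<beta> * (3 * t - (4 - 4 * \<beta>\<^sup>2) * t ^ 3) = 3 * J23_bound (1 - \<beta>)"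
proof (cases "sqrt 3 / 2 \<le> \<beta>")
  case True
  then have "2 * \<beta> * (3 * 1 - (4 - 4 * \<beta>\<^sup>2) * 1 ^ 3) = 3 * J23_bound (1 - \<beta>)"
    by (simp add: J23_bound_def)
  then show thesis using that[of 1] by simp
next
  case False
  then have "\<beta>\<^sup>2 < (sqrt 3 / 2)\<^sup>2" using \<beta> by (intro power_strict_mono) auto
  then have lt: "\<beta>\<^sup>2 < 3 / 4" by (simp add: power_divide)
  define q where "q = sqrt (1 - \<beta>\<^sup>2)"
  have q: "q > 0" "q\<^sup>2 = 1 - \<beta>\<^sup>2" using lt by (auto simp: q_def)
  have "1 / 2 \<le> q" unfolding q_def
    by (rule real_le_rsqrt) (use lt in \<open>simp add: power_divide\<close>)
  moreover have "3 * (1 / (2 * q)) - (4 - 4 * \<beta>\<^sup>2) * (1 / (2 * q)) ^ 3 = 1 / q"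
  proof -
    have "4 - 4 * \<beta>\<^sup>2 = 4 * q\<^sup>2" using q by simp
    show ?thesis
      unfolding \<open>4 - 4 * \<beta>\<^sup>2 = 4 * q\<^sup>2\<close>
      using q(1) by (simp add: power2_eq_square power3_eq_cube field_simps)
  qed
  then have "2 * \<beta> * (3 * (1 / (2 * q)) - (4 - 4 * \<beta>\<^sup>2) * (1 / (2 * q)) ^ 3) = 3 * J23_bound (1 - \<beta>)"
    using False by (simp add: J23_bound_def q_def)
  ultimately show thesis using that[of "1 / (2 * q)"] q(1) by simp
qed

text \<open>Cube roots of unity do not change \<open>\<omega> ^ 3\<close>, and the three resulting
  values of \<open>\<omega> * m\<close> add up to 0, so one of them has nonnegative real
  part.\<close>

lemma cube_root_of_unity_rotation:
  obtains \<omega> where "cmod \<omega> = 1" "\<omega> ^ 3 * X = cmod X" "0 \<le> Re (\<omega> * m)"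
proof -
  define \<omega>0 where "\<omega>0 = cis (- Arg X / 3)"
  define \<zeta> where "\<zeta> = cis (2 * pi / 3)"
  have "Re \<zeta> = - 1 / 2" using cos_120 by (simp add: \<zeta>_def)
  moreover have "\<zeta> ^ 3 = cis (real 3 * (2 * pi / 3))" unfolding \<zeta>_def by (rule Complex.DeMoivre)
  then have \<zeta>3: "\<zeta> ^ 3 = 1" by simp
  moreover have "(\<zeta> - 1) * (1 + \<zeta> + \<zeta>\<^sup>2) = \<zeta> ^ 3 - 1"
    by (simp add: power2_eq_square power3_eq_cube algebra_simps)
  ultimately have sum0: "1 + \<zeta> + \<zeta>\<^sup>2 = 0" by auto
  have "Re (\<omega>0 * m) + Re (\<omega>0 * \<zeta> * m) + Re (\<omega>0 * \<zeta>\<^sup>2 * m) = Re ((1 + \<zeta> + \<zeta>\<^sup>2) * (\<omega>0 * m))"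
    by (simp only: plus_complex.sel(1)[symmetric]) (simp add: algebra_simps)
  then have "0 \<le> Re (\<omega>0 * m) \<or> 0 \<le> Re (\<omega>0 * \<zeta> * m) \<or> 0 \<le> Re (\<omega>0 * \<zeta>\<^sup>2 * m)"
    unfolding sum0 by auto
  then have "\<exists>s\<in>{1, \<zeta>, \<zeta>\<^sup>2}. 0 \<le> Re (\<omega>0 * s * m)" by simp
  then obtain s where s: "s \<in> {1, \<zeta>, \<zeta>\<^sup>2}" "0 \<le> Re (\<omega>0 * s * m)" by blast
  have s3: "s ^ 3 = 1" using s(1) \<zeta>3 by (auto simp: power_mult[symmetric] power2_eq_square power_mult_distrib)
  have "cmod s = 1" using s(1) by (auto simp: \<zeta>_def norm_power)
  moreover have "\<omega>0 ^ 3 * X = cmod X"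
  proof -
    have "\<omega>0 ^ 3 = cis (- Arg X)" by (simp add: \<omega>0_def Complex.DeMoivre)
    moreover have "X = cmod X * cis (Arg X)" using rcis_cmod_Arg[of X] by (simp add: rcis_def)
    ultimately have "\<omega>0 ^ 3 * X = cmod X * (cis (- Arg X) * cis (Arg X))" by (metis mult.left_commute)
    then show ?thesis by (simp add: cis_mult)
  qed
  ultimately show thesis
    using that[of "\<omega>0 * s"] s(2) s3 by (simp add: norm_mult power_mult_distrib \<omega>0_def)
qed

text \<open>After the rotation both coefficients are controlled by the single number
  \<open>a\<close>: the cube of the first because its base has nonnegative real part, the third by
  the test inequality. What remains is a cubic in one variable.\<close>

lemma cubic_coefficient_functional_bound:
  assumes hol: "p holomorphic_on ball 0 1" and p0: "p 0 = 1"
    and Re_p: "\<And>z. cmod z < 1 \<Longrightarrow> \<alpha> < Re (p z)" and \<alpha>: "0 \<le> \<alpha>" "\<alpha> < 1"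
  shows "cmod (deriv p 0 ^ 3 - (deriv ^^ 3) p 0 / 6) \<le> 3 * J23_bound \<alpha>"
proof -
  define \<beta> where "\<beta> = 1 - \<alpha>"
  have \<beta>: "0 < \<beta>" "\<beta> \<le> 1" using \<alpha> by (auto simp: \<beta>_def)
  define X where "X = deriv p 0 ^ 3 - (deriv ^^ 3) p 0 / 6"
  obtain \<omega> where \<omega>: "cmod \<omega> = 1" "\<omega> ^ 3 * X = cmod X" "0 \<le> Re (\<omega> * deriv p 0)"
    using cube_root_of_unity_rotation by blast
  note test = trig_test_inequality[OF hol p0 Re_p _ \<omega>(1), folded \<beta>_def]
  \<comment> \<open>\<open>2 * \<beta>\<close> is Caratheodory's bound for the first coefficient, so
    \<open>a\<close> lies in \<open>[0, 1]\<close>.\<close>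
  define a where "a = Re (\<omega> * deriv p 0) / (2 * \<beta>)"
  have a: "0 \<le> a" "Re (\<omega> * deriv p 0) = 2 * \<beta> * a" using \<omega>(3) \<beta> by (auto simp: a_def)
  \<comment> \<open>The test polynomial here is \<open>1 - cos \<theta>\<close>.\<close>
  have "a \<le> 1" using test[of 1 "-1" 0] a \<beta> by simp
  \<comment> \<open>The bound \<open>8 t^3 + (3 - 12 t^2) a\<close> found below is least at
    \<open>t = a\<close>, but \<open>c + 2 t\<close> is nonnegative on \<open>[-1, 1]\<close> only
    for \<open>t >= 1 / 2\<close>.\<close>
  define t where "t = max a (1 / 2)"
  have t: "1 / 2 \<le> t" "t \<le> 1" using \<open>a \<le> 1\<close> by (auto simp: t_def)
  have "0 \<le> 8 * t ^ 3 * \<beta> + (3 - 12 * t\<^sup>2) / 2 * Re (\<omega> * deriv p 0)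
      + 1 / 2 * Re (\<omega> ^ 3 * ((deriv ^^ 3) p 0 / 6))"
  proof (rule test)
    fix c :: real assume c: "\<bar>c\<bar> \<le> 1"
    have "0 \<le> 4 * (c - t)\<^sup>2 * (c + 2 * t)" using c t by (intro mult_nonneg_nonneg) auto
    also have "\<dots> = 8 * t ^ 3 + (3 - 12 * t\<^sup>2) * c + 1 * (4 * c ^ 3 - 3 * c)"
      by (simp add: power2_eq_square power3_eq_cube algebra_simps)
    finally show "0 \<le> \<dots>" .
  qed
  then have "0 \<le> 8 * t ^ 3 * \<beta> + (3 - 12 * t\<^sup>2) * (\<beta> * a) + 1 / 2 * Re (\<omega> ^ 3 * ((deriv ^^ 3) p 0 / 6))"
    unfolding a(2) by (simp only: times_divide_eq_left times_divide_eq_right mult.assoc)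
  then have m3: "- Re (\<omega> ^ 3 * ((deriv ^^ 3) p 0 / 6)) \<le> 2 * \<beta> * (8 * t ^ 3 + (3 - 12 * t\<^sup>2) * a)"
    unfolding right_diff_distrib left_diff_distrib distrib_left by (simp only: mult_ac)
  \<comment> \<open>\<open>Re (w ^ 3)\<close> falls short of \<open>(Re w) ^ 3\<close> by
    \<open>3 Re w (Im w)^2\<close>, which is nonnegative.\<close>
  have "Re ((\<omega> * deriv p 0) ^ 3) \<le> Re (\<omega> * deriv p 0) ^ 3"
    unfolding Re_cube using \<omega>(3) by (simp del: times_complex.sel)
  also have "\<dots> = 2 * \<beta> * (4 * \<beta>\<^sup>2 * a ^ 3)"
    unfolding a(2) by (simp add: power3_eq_cube power2_eq_square)
  finally have m1: "Re ((\<omega> * deriv p 0) ^ 3) \<le> 2 * \<beta> * (4 * \<beta>\<^sup>2 * a ^ 3)" .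
  have "cmod X = Re (\<omega> ^ 3 * X)" using \<omega>(2) by simp
  also have "\<omega> ^ 3 * X = (\<omega> * deriv p 0) ^ 3 - \<omega> ^ 3 * ((deriv ^^ 3) p 0 / 6)"
    by (simp add: X_def power_mult_distrib algebra_simps)
  also have "Re \<dots> \<le> 2 * \<beta> * (4 * \<beta>\<^sup>2 * a ^ 3) + 2 * \<beta> * (8 * t ^ 3 + (3 - 12 * t\<^sup>2) * a)"
    using m1 m3 by simp
  also have "\<dots> = 2 * \<beta> * (4 * \<beta>\<^sup>2 * a ^ 3 + (8 * t ^ 3 + (3 - 12 * t\<^sup>2) * a))"
    by (simp add: distrib_left)
  also have "\<dots> \<le> 2 * \<beta> * (3 * t - (4 - 4 * \<beta>\<^sup>2) * t ^ 3)"
  proof (rule mult_left_mono)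
    show "4 * \<beta>\<^sup>2 * a ^ 3 + (8 * t ^ 3 + (3 - 12 * t\<^sup>2) * a) \<le> 3 * t - (4 - 4 * \<beta>\<^sup>2) * t ^ 3"
    proof (cases "1 / 2 \<le> a")
      case True
      then have "t = a" by (simp add: t_def)
      then show ?thesis by (simp add: power2_eq_square power3_eq_cube algebra_simps)
    next
      case False
      \<comment> \<open>At this \<open>t\<close> the coefficient \<open>3 - 12 t^2\<close> vanishes,
        and only the cubes of \<open>a\<close> and \<open>1 / 2\<close> are compared.\<close>
      then have "t = 1 / 2" by (simp add: t_def)
      have "\<beta>\<^sup>2 * a ^ 3 \<le> \<beta>\<^sup>2 * (1 / 2) ^ 3"
        using False a(1) by (intro mult_left_mono power_mono) auto
      then show ?thesis
        unfolding \<open>t = 1 / 2\<close> by (simp add: power2_eq_square power3_eq_cube algebra_simps)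
    qed
  qed (use \<beta> in simp)
  also have "\<dots> \<le> 3 * J23_bound \<alpha>"
    using extremal_cubic_bound[of t \<beta>] t \<beta> by (simp add: \<beta>_def)
  finally show ?thesis by (simp add: X_def)
qed

section \<open>Expansions along a complex line\<close>

abbreviation has_cderiv :: "(complex \<Rightarrow> 'a::complex_normed_vector) \<Rightarrow> 'a \<Rightarrow> complex \<Rightarrow> bool" where
  "has_cderiv u u' z \<equiv> (u has_derivative (\<lambda>\<delta>. \<delta> *\<^sub>C u')) (at z)"

lemma has_cderiv_diff:
  assumes "has_cderiv u u' z" "has_cderiv v v' z"
  shows "has_cderiv (\<lambda>\<zeta>. u \<zeta> - v \<zeta>) (u' - v') z"
  using has_derivative_diff[OF assms] by (simp add: scaleC.diff_right)

lemma has_cderiv_scaleC: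
  assumes "(\<phi> has_field_derivative \<phi>') (at z)"
  shows "has_cderiv (\<lambda>\<zeta>. \<phi> \<zeta> *\<^sub>C x) (\<phi>' *\<^sub>C x) z"
  using bounded_linear.has_derivative[OF scaleC.bounded_linear_left
      assms[unfolded has_field_derivative_def], of x]
  by (simp add: scaleC_scaleC mult.commute)

lemma has_cderiv_complex:
  "has_cderiv \<phi> \<phi>' z \<longleftrightarrow> (\<phi> has_field_derivative \<phi>') (at z)"
  by (simp add: has_field_derivative_def mult.commute[of _ \<phi>'] cong: if_cong)

lemma has_cderiv_clinear:
  assumes "has_cderiv u u' z" "bounded_clinear T"
  shows "has_cderiv (\<lambda>\<zeta>. T (u \<zeta>)) (T u') z"
  using bounded_linear.has_derivative[OF bounded_clinearD(1)[OF assms(2)] assms(1)]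
  by (simp add: bounded_clinearD(2)[OF assms(2)])

lemma has_cderiv_blinfun_apply:
  fixes L :: "complex \<Rightarrow> 'c::real_normed_vector \<Rightarrow>\<^sub>L 'b::complex_normed_vector"
  assumes "has_cderiv L L' z"
  shows "has_cderiv (\<lambda>\<zeta>. L \<zeta> y) (L' y) z"
  using bounded_linear.has_derivative[OF blinfun.bounded_linear_left[of y] assms]
  by (simp add: scaleC_blinfun.rep_eq)

lemma has_cderiv_line:
  assumes "holomorphic_on_ball G" "norm (z *\<^sub>C x) < 1"
  shows "has_cderiv (\<lambda>\<zeta>. G (\<zeta> *\<^sub>C x)) (fderiv G (z *\<^sub>C x) x) z"
  using has_derivative_along[of G "fderiv G (z *\<^sub>C x)" 0 z x] holomorphic_on_ballD[OF assms] by simp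

text \<open>Each further derivative uses \<open>holomorphic_on_ball_fderiv\<close> once more;
  differentiating along the line inserts one more argument \<open>x\<close>.\<close>

lemma has_cderiv_iterated_line:
  fixes F :: "'a::complex_normed_vector \<Rightarrow> 'b::complex_banach"
  assumes F: "holomorphic_on_ball F" and z: "norm (z *\<^sub>C x) < 1"
  shows "has_cderiv (\<lambda>\<zeta>. F (\<zeta> *\<^sub>C x)) (fderiv F (z *\<^sub>C x) x) z"
    "has_cderiv (\<lambda>\<zeta>. fderiv F (\<zeta> *\<^sub>C x) y) (fderiv (fderiv F) (z *\<^sub>C x) x y) z"
    "has_cderiv (\<lambda>\<zeta>. fderiv2_diag F (\<zeta> *\<^sub>C x) x) (fderiv3_diag F (z *\<^sub>C x) x) z"
    "has_cderiv (\<lambda>\<zeta>. fderiv3_diag F (\<zeta> *\<^sub>C x) x) (fderiv4_diag F (z *\<^sub>C x) x) z"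
proof -
  note D1 = holomorphic_on_ball_fderiv[OF F]
  note D2 = holomorphic_on_ball_fderiv[OF D1]
  note D3 = holomorphic_on_ball_fderiv[OF D2]
  show "has_cderiv (\<lambda>\<zeta>. F (\<zeta> *\<^sub>C x)) (fderiv F (z *\<^sub>C x) x) z"
    by (rule has_cderiv_line[OF F z])
  show "has_cderiv (\<lambda>\<zeta>. fderiv F (\<zeta> *\<^sub>C x) y) (fderiv (fderiv F) (z *\<^sub>C x) x y) z"
    by (intro has_cderiv_blinfun_apply has_cderiv_line D1 z)
  show "has_cderiv (\<lambda>\<zeta>. fderiv2_diag F (\<zeta> *\<^sub>C x) x) (fderiv3_diag F (z *\<^sub>C x) x) z"
    unfolding fderiv2_diag_def fderiv3_diag_def by (intro has_cderiv_blinfun_apply has_cderiv_line D2 z)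
  show "has_cderiv (\<lambda>\<zeta>. fderiv3_diag F (\<zeta> *\<^sub>C x) x) (fderiv4_diag F (z *\<^sub>C x) x) z"
    unfolding fderiv3_diag_def fderiv4_diag_def by (intro has_cderiv_blinfun_apply has_cderiv_line D3 z)
qed

text \<open>The filter includes the origin itself, so for \<open>n > 0\<close> the estimate forces
  \<open>v 0 = 0\<close>.\<close>

definition small_o :: "nat \<Rightarrow> (complex \<Rightarrow> 'a::real_normed_vector) \<Rightarrow> bool" where
  "small_o n v \<longleftrightarrow> (\<forall>e>0. \<forall>\<^sub>F \<zeta> in nhds 0. norm (v \<zeta>) \<le> e * cmod \<zeta> ^ n)"

lemma small_oD: "small_o n v \<Longrightarrow> e > 0 \<Longrightarrow> \<forall>\<^sub>F \<zeta> in nhds 0. norm (v \<zeta>) \<le> e * cmod \<zeta> ^ n"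
  by (auto simp: small_o_def)

lemma small_o_bound:
  assumes v: "small_o n v" and C: "C \<ge> 0" and le: "\<forall>\<^sub>F \<zeta> in nhds 0. norm (w \<zeta>) \<le> C * cmod \<zeta> ^ m * norm (v \<zeta>)"
  shows "small_o (n + m) w"
  unfolding small_o_def
proof (intro allI impI)
  fix e :: real assume e: "e > 0"
  have "e / (C + 1) > 0" using e C by simp
  from small_oD[OF v this] le show "\<forall>\<^sub>F \<zeta> in nhds 0. norm (w \<zeta>) \<le> e * cmod \<zeta> ^ (n + m)"
  proof eventually_elim
    case (elim \<zeta>)
    have "norm (w \<zeta>) \<le> C * cmod \<zeta> ^ m * (e / (C + 1) * cmod \<zeta> ^ n)"
      using elim C by (meson mult_left_mono mult_nonneg_nonneg norm_ge_zero order_trans zero_le_power)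
    also have "\<dots> = (C / (C + 1)) * (e * cmod \<zeta> ^ (n + m))" by (simp add: power_add)
    also have "\<dots> \<le> 1 * (e * cmod \<zeta> ^ (n + m))" using C e by (intro mult_right_mono) auto
    finally show ?case by simp
  qed
qed

lemma small_o_add:
  assumes "small_o n u" "small_o n v" shows "small_o n (\<lambda>\<zeta>. u \<zeta> + v \<zeta>)"
  unfolding small_o_def
proof (intro allI impI)
  fix e :: real assume "e > 0"
  then have "e / 2 > 0" by simp
  from small_oD[OF assms(1) this] small_oD[OF assms(2) this]
  show "\<forall>\<^sub>F \<zeta> in nhds 0. norm (u \<zeta> + v \<zeta>) \<le> e * cmod \<zeta> ^ n"
  proof eventually_elim
    case (elim \<zeta>)
    then show ?case using norm_triangle_ineq[of "u \<zeta>" "v \<zeta>"] by simp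
  qed
qed

lemma small_o_zero:
  assumes "small_o n v" "n > 0" shows "v 0 = 0"
  using eventually_nhds_x_imp_x[OF small_oD[OF assms(1) zero_less_one]] assms(2)
  by (simp add: power_0_left)

lemma eventually_cont_bound:
  fixes r :: "complex \<Rightarrow> complex"
  assumes "isCont r 0"
  shows "\<forall>\<^sub>F \<zeta> in nhds 0. cmod (r \<zeta>) \<le> cmod (r 0) + 1"
proof -
  have "((\<lambda>\<zeta>. cmod (r \<zeta>)) \<longlongrightarrow> cmod (r 0)) (nhds 0)"
    using assms by (intro tendsto_norm) (simp add: continuous_at tendsto_nhds_iff)
  then have "\<forall>\<^sub>F \<zeta> in nhds 0. cmod (r \<zeta>) < cmod (r 0) + 1" by (rule order_tendstoD) simp
  then show ?thesis by eventually_elim simp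
qed

lemma small_o_scaleC:
  fixes v :: "complex \<Rightarrow> 'a::complex_normed_vector"
  assumes "small_o n v" "isCont r 0"
  shows "small_o (n + m) (\<lambda>\<zeta>. (\<zeta> ^ m * r \<zeta>) *\<^sub>C v \<zeta>)"
proof (rule small_o_bound[OF assms(1)])
  show "\<forall>\<^sub>F \<zeta> in nhds 0. norm ((\<zeta> ^ m * r \<zeta>) *\<^sub>C v \<zeta>) \<le> (cmod (r 0) + 1) * cmod \<zeta> ^ m * norm (v \<zeta>)"
    using eventually_cont_bound[OF assms(2)]
  proof eventually_elim
    case (elim \<zeta>)
    from mult_right_mono[OF mult_right_mono[OF elim, of "cmod \<zeta> ^ m"], of "norm (v \<zeta>)"]
    show ?case by (simp add: norm_scaleC norm_mult norm_power mult.commute)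
  qed
qed simp

lemma small_o_power:
  fixes x :: "'a::complex_normed_vector"
  assumes "isCont r 0"
  shows "small_o n (\<lambda>\<zeta>. (\<zeta> ^ Suc n * r \<zeta>) *\<^sub>C x)"
proof -
  have "small_o 0 (\<lambda>\<zeta>. \<zeta> *\<^sub>C x)"
    unfolding small_o_def
  proof (intro allI impI)
    fix e :: real assume "e > 0"
    have "((\<lambda>\<zeta>. norm (\<zeta> *\<^sub>C x)) \<longlongrightarrow> norm (0 *\<^sub>C x)) (nhds 0)"
      by (intro tendsto_norm scaleC.tendsto tendsto_const filterlim_ident)
    then have "\<forall>\<^sub>F \<zeta> in nhds 0. norm (\<zeta> *\<^sub>C x) < e" by (rule order_tendstoD) (simp add: \<open>e > 0\<close>)
    then show "\<forall>\<^sub>F \<zeta> in nhds 0. norm (\<zeta> *\<^sub>C x) \<le> e * cmod \<zeta> ^ 0" by eventually_elim simp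
  qed
  from small_o_scaleC[OF this assms, of n] show ?thesis
    by (simp add: scaleC_scaleC mult_ac)
qed

lemma small_o_has_cderiv_zero:
  assumes "has_cderiv v 0 0" "v 0 = 0"
  shows "small_o 1 v"
  unfolding small_o_def
proof (intro allI impI)
  fix e :: real assume "e > 0"
  then obtain d where "d > 0" "\<And>y. cmod (y - 0) < d \<Longrightarrow> norm (v y - v 0 - y *\<^sub>C 0) \<le> e * cmod (y - 0)"
    using assms(1) unfolding has_derivative_at_alt by fastforce
  then show "\<forall>\<^sub>F \<zeta> in nhds 0. norm (v \<zeta>) \<le> e * cmod \<zeta> ^ 1"
    unfolding eventually_nhds_metric using assms(2) by (auto simp: scaleC.zero_right)
qed

text \<open>The mean value inequality on the disc of radius \<open>cmod \<zeta>\<close> gains one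
  order.\<close>

lemma small_o_integrate:
  assumes der: "\<And>z. cmod z < 1 \<Longrightarrow> has_cderiv v (v' z) z" and v0: "v 0 = 0" and v': "small_o n v'"
  shows "small_o (Suc n) v"
  unfolding small_o_def
proof (intro allI impI)
  fix e :: real assume e: "e > 0"
  then obtain d where d: "d > 0" "\<And>y. cmod y < d \<Longrightarrow> norm (v' y) \<le> e * cmod y ^ n"
    using small_oD[OF v'] unfolding eventually_nhds_metric by fastforce
  have "norm (v \<zeta>) \<le> e * cmod \<zeta> ^ Suc n" if \<zeta>: "cmod \<zeta> < min d 1" for \<zeta>
  proof -
    have "norm (v \<zeta> - v 0) \<le> (e * cmod \<zeta> ^ n) * norm (\<zeta> - 0)"
    proof (rule differentiable_bound[where S = "cball 0 (cmod \<zeta>)" and f' = "\<lambda>z \<delta>. \<delta> *\<^sub>C v' z"])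
      fix z :: complex assume "z \<in> cball 0 (cmod \<zeta>)"
      then have z: "cmod z \<le> cmod \<zeta>" by simp
      then show "(v has_derivative (\<lambda>\<delta>. \<delta> *\<^sub>C v' z)) (at z within cball 0 (cmod \<zeta>))"
        using \<zeta> by (intro has_derivative_at_withinI[OF der]) simp
      have "norm (v' z) \<le> e * cmod z ^ n" using z \<zeta> by (intro d(2)) simp
      also have "\<dots> \<le> e * cmod \<zeta> ^ n" using z e by (intro mult_left_mono power_mono) auto
      finally have le: "norm (v' z) \<le> e * cmod \<zeta> ^ n" .
      show "onorm (\<lambda>\<delta>. \<delta> *\<^sub>C v' z) \<le> e * cmod \<zeta> ^ n"
      proof (rule onorm_bound)
        show "0 \<le> e * cmod \<zeta> ^ n" using e by simp
        show "norm (\<delta> *\<^sub>C v' z) \<le> e * cmod \<zeta> ^ n * norm \<delta>" for \<delta>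
          using mult_left_mono[OF le norm_ge_zero[of \<delta>]] by (simp add: norm_scaleC mult.commute)
      qed
    qed (auto simp: convex_cball)
    then show ?thesis by (simp add: v0 mult_ac)
  qed
  then show "\<forall>\<^sub>F \<zeta> in nhds 0. norm (v \<zeta>) \<le> e * cmod \<zeta> ^ Suc n"
    unfolding eventually_nhds_metric using d(1) by (intro exI[of _ "min d 1"]) auto
qed

text \<open>Taylor's formula with Peano remainder. The third derivative is differentiable at the
  origin, so its remainder \<open>v3\<close> has order 1; integrating three times gives
  \<open>v2\<close>, \<open>v1\<close>, \<open>v0\<close> of orders 2, 3, 4.\<close>

lemma radial_line_expansion:
  fixes F :: "'a::complex_normed_vector \<Rightarrow> 'b::complex_banach"
  assumes F: "holomorphic_on_ball F" and x: "norm x \<le> 1"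
    and F0: "F 0 = 0" "fderiv F 0 x = y"
    and D: "fderiv2_diag F 0 x = (2 * a) *\<^sub>C y" "fderiv3_diag F 0 x = (6 * b) *\<^sub>C y"
      "fderiv4_diag F 0 x = (24 * c) *\<^sub>C y"
  shows "small_o 4 (\<lambda>\<zeta>. F (\<zeta> *\<^sub>C x) - (\<zeta> + a * \<zeta>^2 + b * \<zeta>^3 + c * \<zeta>^4) *\<^sub>C y)"
    and "small_o 3 (\<lambda>\<zeta>. fderiv F (\<zeta> *\<^sub>C x) x - (1 + 2 * a * \<zeta> + 3 * b * \<zeta>^2 + 4 * c * \<zeta>^3) *\<^sub>C y)"
proof -
  have in_ball: "norm (z *\<^sub>C x) < 1" if "cmod z < 1" for z
    using that x mult_left_mono[OF x, of "cmod z"] by (simp add: norm_scaleC)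
  note der = has_cderiv_iterated_line[OF F in_ball]
  define v3 where "v3 \<zeta> = fderiv3_diag F (\<zeta> *\<^sub>C x) x - (6 * b + 24 * c * \<zeta>) *\<^sub>C y" for \<zeta>
  define v2 where "v2 \<zeta> = fderiv2_diag F (\<zeta> *\<^sub>C x) x - (2 * a + 6 * b * \<zeta> + 12 * c * \<zeta>^2) *\<^sub>C y" for \<zeta>
  define v1 where "v1 \<zeta> = fderiv F (\<zeta> *\<^sub>C x) x - (1 + 2 * a * \<zeta> + 3 * b * \<zeta>^2 + 4 * c * \<zeta>^3) *\<^sub>C y" for \<zeta>
  define v0 where "v0 \<zeta> = F (\<zeta> *\<^sub>C x) - (\<zeta> + a * \<zeta>^2 + b * \<zeta>^3 + c * \<zeta>^4) *\<^sub>C y" for \<zeta>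
  have "has_cderiv v3 (fderiv4_diag F (0 *\<^sub>C x) x - (24 * c) *\<^sub>C y) 0"
    unfolding v3_def by (intro has_cderiv_diff has_cderiv_scaleC der) (auto intro!: derivative_eq_intros)
  then have s3: "small_o 1 v3"
    by (intro small_o_has_cderiv_zero) (use D in \<open>simp_all add: v3_def\<close>)
  have d2: "has_cderiv v2 (v3 z) z" if "cmod z < 1" for z
    unfolding v2_def v3_def
    by (intro has_cderiv_diff has_cderiv_scaleC der that) (auto intro!: derivative_eq_intros)
  have s2: "small_o (Suc 1) v2"
    by (rule small_o_integrate[OF d2 _ s3]) (use D in \<open>simp_all add: v2_def\<close>)
  have d1: "has_cderiv v1 (v2 z) z" if "cmod z < 1" for z
    unfolding v1_def v2_def fderiv2_diag_def
    by (intro has_cderiv_diff has_cderiv_scaleC der that) (auto intro!: derivative_eq_intros)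
  have s1: "small_o (Suc (Suc 1)) v1"
    by (rule small_o_integrate[OF d1 _ s2]) (use F0 in \<open>simp_all add: v1_def\<close>)
  have d0: "has_cderiv v0 (v1 z) z" if "cmod z < 1" for z
    unfolding v0_def v1_def
    by (intro has_cderiv_diff has_cderiv_scaleC der that) (auto intro!: derivative_eq_intros)
  have s0: "small_o (Suc (Suc (Suc 1))) v0"
    by (rule small_o_integrate[OF d0 _ s1]) (use F0 in \<open>simp_all add: v0_def\<close>)
  show "small_o 4 (\<lambda>\<zeta>. F (\<zeta> *\<^sub>C x) - (\<zeta> + a * \<zeta>^2 + b * \<zeta>^3 + c * \<zeta>^4) *\<^sub>C y)"
    using s0 unfolding v0_def by (simp add: eval_nat_numeral)
  show "small_o 3 (\<lambda>\<zeta>. fderiv F (\<zeta> *\<^sub>C x) x - (1 + 2 * a * \<zeta> + 3 * b * \<zeta>^2 + 4 * c * \<zeta>^3) *\<^sub>C y)"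
    using s1 unfolding v1_def by (simp add: eval_nat_numeral)
qed

text \<open>For an operator within \<open>1 / (2 * K)\<close> of \<open>D a\<close>, the
  perturbation costs at most \<open>norm v / 2\<close>, which is absorbed on the left.\<close>

lemma lower_bound_perturb:
  fixes D :: "'a::t2_space \<Rightarrow> 'b::real_normed_vector \<Rightarrow>\<^sub>L 'c::real_normed_vector"
  assumes cont: "isCont D a" and K: "K > 0" and lower: "\<And>v. norm v \<le> K * norm (D a v)"
  shows "\<forall>\<^sub>F x in nhds a. \<forall>v. norm v \<le> 2 * K * norm (D x v)"
proof -
  have "((\<lambda>x. norm (D x - D a)) \<longlongrightarrow> norm (D a - D a)) (nhds a)"
    using cont by (intro tendsto_intros) (simp add: continuous_at tendsto_nhds_iff)
  then have "\<forall>\<^sub>F x in nhds a. norm (D x - D a) < 1 / (2 * K)"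
    by (rule order_tendstoD) (simp add: K)
  then show ?thesis
  proof eventually_elim
    case (elim x)
    show ?case
    proof
      fix v
      have "norm ((D x - D a) v) \<le> 1 / (2 * K) * norm v"
        by (rule order_trans[OF norm_blinfun mult_right_mono]) (use elim in auto)
      moreover have "norm (D a v) \<le> norm (D x v) + norm ((D x - D a) v)"
        using norm_triangle_ineq4[of "D x v" "(D x - D a) v"] by (simp add: blinfun.diff_left)
      ultimately have "norm (D a v) \<le> norm (D x v) + 1 / (2 * K) * norm v" by simp
      then have "K * norm (D a v) \<le> K * (norm (D x v) + 1 / (2 * K) * norm v)"
        using K by (intro mult_left_mono) auto
      also have "\<dots> = K * norm (D x v) + norm v / 2" using K by (simp add: field_simps)
      finally show "norm v \<le> 2 * K * norm (D x v)" using lower[of v] by simp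
    qed
  qed
qed

lemma has_cderiv_bounded_by:
  assumes M: "has_cderiv M 0 z" "M z = 0" and V: "V z = 0"
    and le: "\<forall>\<^sub>F \<zeta> in nhds z. norm (V \<zeta>) \<le> C * norm (M \<zeta>)"
  shows "has_cderiv V 0 z"
proof -
  have "((\<lambda>y. norm (M y - M z - (y - z) *\<^sub>C 0) / norm (y - z)) \<longlongrightarrow> 0) (at z)"
    using M(1) unfolding has_derivative_iff_norm by blast
  then have lim: "((\<lambda>y. C * (norm (M y) / norm (y - z))) \<longlongrightarrow> 0) (at z)"
    using tendsto_mult_left[of _ 0 "at z" C] by (auto simp: M(2) scaleC.zero_right simp del: times_divide_eq_right)
  have "((\<lambda>y. norm (V y - V z - (y - z) *\<^sub>C 0) / norm (y - z)) \<longlongrightarrow> 0) (at z)"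
  proof (rule Lim_null_comparison[OF _ lim])
    show "\<forall>\<^sub>F y in at z. norm (norm (V y - V z - (y - z) *\<^sub>C 0) / norm (y - z)) \<le> C * (norm (M y) / norm (y - z))"
      using eventually_at_topological le[unfolded eventually_nhds]
      by (auto simp: V scaleC.zero_right eventually_at_topological intro!: divide_right_mono)
  qed
  then show ?thesis
    unfolding has_derivative_iff_norm by (auto intro: scaleC.bounded_linear_left)
qed

lemma bij_inverse_lower_bound:
  fixes A :: "'a::real_normed_vector \<Rightarrow>\<^sub>L 'b::real_normed_vector"
  assumes "bij (blinfun_apply A)" "bounded_linear (inv (blinfun_apply A))"
  obtains K where "K > 0" "\<And>v. norm v \<le> K * norm (A v)"
proof -
  obtain K where K: "K > 0" "\<And>w. norm (inv A w) \<le> norm w * K"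
    using bounded_linear.pos_bounded[OF assms(2)] by blast
  then show thesis
    using that[of K] assms(1) by (metis bij_is_inj inv_f_f mult.commute)
qed

lemma locally_biholomorphicD:
  assumes "locally_biholomorphic F"
  shows "holomorphic_on_ball F" "norm x < 1 \<Longrightarrow> bij (blinfun_apply (fderiv F x))"
    "norm x < 1 \<Longrightarrow> bounded_linear (inv (blinfun_apply (fderiv F x)))"
  using assms by (auto simp: locally_biholomorphic_def)

text \<open>\<open>w\<close> solves \<open>D \<zeta> (w \<zeta>) = F (\<zeta> x)\<close>. Formal
  differentiation yields the candidate derivative \<open>e\<close>; \<open>D \<zeta>\<close> maps
  its error to a residual that is small to first order, and a lower bound for
  \<open>D \<zeta>\<close>, uniform near \<open>z\<close>, carries the smallness back.\<close>

lemma has_cderiv_inverse_line: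
  fixes F :: "'a::complex_banach \<Rightarrow> 'a"
  assumes F: "locally_biholomorphic F" and z: "norm (z *\<^sub>C x) < 1"
  defines "w \<equiv> \<lambda>\<zeta>. inv (blinfun_apply (fderiv F (\<zeta> *\<^sub>C x))) (F (\<zeta> *\<^sub>C x))"
  shows "\<exists>w'. has_cderiv w w' z"
proof -
  define D where "D \<zeta> = fderiv F (\<zeta> *\<^sub>C x)" for \<zeta>
  note hol = locally_biholomorphicD(1)[OF F]
  have D: "has_cderiv D (fderiv (fderiv F) (z *\<^sub>C x) x) z"
    unfolding D_def by (rule has_cderiv_line[OF holomorphic_on_ball_fderiv[OF hol] z])
  then have contD: "isCont D z" by (rule has_derivative_continuous)
  have near: "\<forall>\<^sub>F \<zeta> in nhds z. norm (\<zeta> *\<^sub>C x) < 1"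
  proof (rule order_tendstoD(2)[OF _ z])
    show "((\<lambda>\<zeta>. norm (\<zeta> *\<^sub>C x)) \<longlongrightarrow> norm (z *\<^sub>C x)) (nhds z)"
      by (intro tendsto_norm scaleC.tendsto tendsto_const filterlim_ident)
  qed
  then have eq: "\<forall>\<^sub>F \<zeta> in nhds z. D \<zeta> (w \<zeta>) = F (\<zeta> *\<^sub>C x)"
    by eventually_elim (simp add: D_def w_def bij_is_surj locally_biholomorphicD[OF F] surj_f_inv_f)
  then have eqz: "D z (w z) = F (z *\<^sub>C x)" by (rule eventually_nhds_x_imp_x)
  have bij: "bij (blinfun_apply (D z))" "bounded_linear (inv (blinfun_apply (D z)))"
    using locally_biholomorphicD[OF F] z by (auto simp: D_def)
  obtain K where K: "K > 0" "\<And>v. norm v \<le> K * norm (D z v)"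
    using bij_inverse_lower_bound[OF bij] by blast
  \<comment> \<open>By the product rule, \<open>D z\<close> applied to the derivative of
    \<open>w\<close> must be \<open>n'\<close>.\<close>
  define n' where "n' = fderiv F (z *\<^sub>C x) x - fderiv (fderiv F) (z *\<^sub>C x) x (w z)"
  define e where "e = inv (D z) n'"
  have e: "D z e = n'" by (simp add: e_def bij bij_is_surj surj_f_inv_f)
  \<comment> \<open>Near \<open>z\<close> this is \<open>D \<zeta>\<close> applied to the error
    \<open>w \<zeta> - w z - (\<zeta> - z) e\<close>.\<close>
  define M where "M \<zeta> = F (\<zeta> *\<^sub>C x) - D \<zeta> (w z) - (\<zeta> - z) *\<^sub>C D \<zeta> e" for \<zeta>
  have N: "has_cderiv (\<lambda>\<zeta>. F (\<zeta> *\<^sub>C x) - D \<zeta> (w z)) n' z"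
    unfolding n'_def by (intro has_cderiv_diff has_cderiv_line hol z has_cderiv_blinfun_apply D)
  have "((\<lambda>\<zeta>. (\<zeta> - z) *\<^sub>C D \<zeta> e) has_derivative (\<lambda>\<delta>. \<delta> *\<^sub>C D z e)) (at z)"
  proof -
    have "((\<lambda>\<zeta>. \<zeta> - z) has_derivative (\<lambda>\<delta>. \<delta>)) (at z)" by (auto intro!: derivative_eq_intros)
    from scaleC.FDERIV[OF this has_cderiv_blinfun_apply[OF D, of e]] show ?thesis by simp
  qed
  from has_cderiv_diff[OF N this] have M: "has_cderiv M 0 z" by (simp add: M_def[abs_def] e)
  have "has_cderiv (\<lambda>\<zeta>. w \<zeta> - w z - (\<zeta> - z) *\<^sub>C e) 0 z"
  proof (rule has_cderiv_bounded_by[OF M])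
    show "\<forall>\<^sub>F \<zeta> in nhds z. norm (w \<zeta> - w z - (\<zeta> - z) *\<^sub>C e) \<le> 2 * K * norm (M \<zeta>)"
      using lower_bound_perturb[OF contD K] eq near
    proof eventually_elim
      case (elim \<zeta>)
      have "D \<zeta> ((\<zeta> - z) *\<^sub>C e) = (\<zeta> - z) *\<^sub>C D \<zeta> e"
        unfolding D_def by (rule bounded_clinearD(2)[OF holomorphic_on_ballD(2)[OF hol elim(3)]])
      then have "D \<zeta> (w \<zeta> - w z - (\<zeta> - z) *\<^sub>C e) = M \<zeta>"
        using elim(2) by (simp add: M_def blinfun.diff_right)
      then show ?case using elim(1)[rule_format, of "w \<zeta> - w z - (\<zeta> - z) *\<^sub>C e"] by simp
    qed
  qed (simp_all add: M_def eqz)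
  moreover have "has_cderiv (\<lambda>\<zeta>. w z + (\<zeta> - z) *\<^sub>C e) e z"
  proof -
    have "((\<lambda>\<zeta>. \<zeta> - z) has_field_derivative 1) (at z)" by (auto intro!: derivative_eq_intros)
    from has_derivative_add[OF has_derivative_const has_cderiv_scaleC[OF this, of e], of "w z"]
    show ?thesis by simp
  qed
  ultimately have "has_cderiv (\<lambda>\<zeta>. (w \<zeta> - w z - (\<zeta> - z) *\<^sub>C e) + (w z + (\<zeta> - z) *\<^sub>C e)) e z"
    by (rule has_derivative_add[THEN has_derivative_eq_rhs]) (simp add: scaleC.zero_right)
  then show ?thesis by auto
qed

section \<open>The upper bound\<close>

text \<open>Cauchy's inequality on small circles gives \<open>fact k * e * r ^ (n - k)\<close>;
  since \<open>e\<close> is arbitrary, this covers \<open>k = n\<close> too.\<close>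

lemma small_o_higher_deriv:
  fixes v :: "complex \<Rightarrow> complex"
  assumes hol: "v holomorphic_on ball 0 1" and v: "small_o n v" and k: "k \<le> n"
  shows "(deriv ^^ k) v 0 = 0"
proof -
  have "cmod ((deriv ^^ k) v 0) \<le> fact k * e" if e: "e > 0" for e
  proof -
    obtain d where d: "d > 0" "\<And>y. cmod y < d \<Longrightarrow> cmod (v y) \<le> e * cmod y ^ n"
      using small_oD[OF v e] unfolding eventually_nhds_metric by auto
    define r where "r = min d 1 / 2"
    have r: "0 < r" "r < d" "r < 1" using d(1) by (auto simp: r_def)
    have "cmod ((deriv ^^ k) v 0) \<le> fact k * (e * r ^ n) / r ^ k"
    proof (rule Cauchy_inequality)
      show "v holomorphic_on ball 0 r" by (rule holomorphic_on_subset[OF hol]) (use r in auto)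
      show "continuous_on (cball 0 r) v"
        by (rule holomorphic_on_imp_continuous_on[OF holomorphic_on_subset[OF hol]]) (use r in auto)
      show "cmod (v x) \<le> e * r ^ n" if "cmod (0 - x) = r" for x
        using d(2)[of x] that r by simp
    qed (rule r)
    also have "\<dots> = fact k * e * r ^ (n - k)"
      using k r by (simp add: power_diff)
    also have "\<dots> \<le> fact k * e * 1"
      using e r by (intro mult_left_mono power_le_one) auto
    finally show ?thesis by simp
  qed
  then have "cmod ((deriv ^^ k) v 0) \<le> 0 + e" if "e > 0" for e
    using that by (metis add_0 divide_pos_pos fact_gt_zero nonzero_mult_div_cancel_left
        order_less_irrefl times_divide_eq_right)
  then have "cmod ((deriv ^^ k) v 0) \<le> 0" by (rule field_le_epsilon)
  then show ?thesis by simp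
qed

text \<open>Both sides say \<open>\<alpha> |g|^2 < Re g\<close>: the boundary circle of the disc
  passes through 0, so inversion maps the disc onto a half-plane.\<close>

lemma disc_iff_Re_inverse:
  assumes "g \<noteq> 0" "\<alpha> > 0"
  shows "cmod (g - 1 / (2 * complex_of_real \<alpha>)) < 1 / (2 * \<alpha>) \<longleftrightarrow> \<alpha> < Re (1 / g)"
proof -
  define x y where "x = Re g" and "y = Im g"
  have pos: "x\<^sup>2 + y\<^sup>2 > 0" using assms(1) by (auto simp: x_def y_def complex_eq_iff sum_power2_gt_zero_iff)
  have "(1 / (2 * \<alpha>))\<^sup>2 \<le> (cmod (g - 1 / (2 * complex_of_real \<alpha>)))\<^sup>2
      \<longleftrightarrow> 1 / (2 * \<alpha>) \<le> cmod (g - 1 / (2 * complex_of_real \<alpha>))"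
    by (rule power_mono_iff) (use assms(2) in auto)
  then have "cmod (g - 1 / (2 * complex_of_real \<alpha>)) < 1 / (2 * \<alpha>)
      \<longleftrightarrow> (cmod (g - 1 / (2 * complex_of_real \<alpha>)))\<^sup>2 < (1 / (2 * \<alpha>))\<^sup>2"
    by (simp only: not_le[symmetric])
  also have "1 / (2 * complex_of_real \<alpha>) = complex_of_real (1 / (2 * \<alpha>))" by simp
  also have "(cmod (g - complex_of_real (1 / (2 * \<alpha>))))\<^sup>2 = (x - 1 / (2 * \<alpha>))\<^sup>2 + y\<^sup>2"
    by (simp add: cmod_power2 x_def y_def)
  also have "\<dots> < (1 / (2 * \<alpha>))\<^sup>2 \<longleftrightarrow> x\<^sup>2 + y\<^sup>2 < x / \<alpha>"
    using assms(2) by (simp add: power2_eq_square algebra_simps)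
  also have "\<dots> \<longleftrightarrow> \<alpha> < x / (x\<^sup>2 + y\<^sup>2)"
    using assms(2) pos by (simp add: field_simps)
  also have "x / (x\<^sup>2 + y\<^sup>2) = Re (1 / g)" by (simp add: x_def y_def Re_divide)
  finally show ?thesis by simp
qed

section \<open>Starlikeness restricted to a complex line\<close>

lemma support_functional_norm_le:
  assumes "T \<in> support_functionals x" shows "cmod (T y) \<le> norm y"
  using onorm[of T y] assms by (simp add: support_functionals_def bounded_clinear_def)

text \<open>Starlikeness at \<open>z x\<close> refers to functionals supporting \<open>z x\<close>;
  removing the phase of \<open>z\<close> obtains one from \<open>T\<close>.\<close>

lemma support_functional_rotate:
  fixes x :: "'a::complex_normed_vector"
  assumes T: "T \<in> support_functionals x" and x: "norm x = 1" and z: "z \<noteq> 0"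
  shows "(\<lambda>y. cnj z / cmod z * T y) \<in> support_functionals (z *\<^sub>C x)"
proof -
  have c: "cmod (cnj z / cmod z) = 1" using z by (simp add: norm_divide)
  have T': "bounded_clinear T" "onorm T = 1" "T x = 1" using T x by (auto simp: support_functionals_def)
  have "bounded_clinear (\<lambda>y. cnj z / cmod z * T y)"
    using T'(1) bounded_linear_const_mult[of T "cnj z / cmod z"] by (simp add: bounded_clinear_def)
  moreover have "onorm (\<lambda>y. cnj z / cmod z * T y) = onorm T"
    unfolding onorm_def norm_mult c by simp
  moreover have "cnj z / cmod z * T (z *\<^sub>C x) = norm (z *\<^sub>C x)"
    using z complex_norm_square[of z] x
    by (simp add: bounded_clinearD(2)[OF T'(1)] T'(3) norm_scaleC power2_eq_square field_simps)
  ultimately show ?thesis using T'(2) by (simp add: support_functionals_def)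
qed

text \<open>Both branches of the definition become one half-plane condition: for
  \<open>\<alpha> = 0\<close> because a number and its reciprocal have real parts of the same sign,
  for \<open>\<alpha> > 0\<close> by inverting the disc.\<close>

lemma starlike_of_orderD:
  fixes F :: "'a::complex_normed_vector \<Rightarrow> 'a"
  assumes F: "F \<in> starlike_of_order \<alpha>" and \<alpha>: "0 \<le> \<alpha>" and x: "norm x = 1"
    and T: "T \<in> support_functionals x" and z: "z \<noteq> 0" "cmod z < 1"
  defines "G \<equiv> T (inv (blinfun_apply (fderiv F (z *\<^sub>C x))) (F (z *\<^sub>C x)))"
  shows "G \<noteq> 0 \<and> \<alpha> < Re (z / G)"
proof -
  have "z *\<^sub>C x \<noteq> 0" using z x by (metis norm_eq_zero norm_scaleC mult_cancel_left1 norm_zero zero_neq_one)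
  then have in_ball: "z *\<^sub>C x \<in> ball 0 1 - {0}" using z x by (simp add: norm_scaleC)
  \<comment> \<open>The phase and the factor \<open>1 / norm (z x)\<close> combine to
    \<open>1 / z\<close>.\<close>
  have "1 / complex_of_real (norm (z *\<^sub>C x)) * (cnj z / cmod z * G) = (cnj z / (z * cnj z)) * G"
    using z x complex_norm_square[of z] by (simp add: norm_scaleC power2_eq_square)
  then have Gz: "1 / complex_of_real (norm (z *\<^sub>C x)) * (cnj z / cmod z * G) = G / z"
    using z by simp
  have *: "if \<alpha> = 0 then Re (cnj z / cmod z * G) > 0 else cmod (G / z - 1 / (2 * complex_of_real \<alpha>)) < 1 / (2 * \<alpha>)"
  proof -
    have "\<forall>y\<in>ball 0 1 - {0}. \<forall>T\<in>support_functionals y.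
            if \<alpha> = 0 then Re (T (inv (blinfun_apply (fderiv F y)) (F y))) > 0
            else cmod (1 / complex_of_real (norm y) * T (inv (blinfun_apply (fderiv F y)) (F y))
                       - 1 / (2 * complex_of_real \<alpha>)) < 1 / (2 * \<alpha>)"
      using F unfolding starlike_of_order_def by blast
    from bspec[OF bspec[OF this in_ball] support_functional_rotate[OF T x z(1)]]
    show ?thesis by (simp only: G_def[symmetric] Gz)
  qed
  show ?thesis
  proof (cases "\<alpha> = 0")
    case True
    then have pos: "0 < Re (cnj z / cmod z * G)" using * by simp
    have "cnj z / cmod z * G = complex_of_real (cmod z) * (G / z)"
      using z complex_norm_square[of z] by (simp add: power2_eq_square field_simps)
    then have "0 < cmod z * Re (G / z)" using pos by (simp only: Re_complex_of_real times_complex.sel Im_complex_of_real)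
    then have "0 < Re (G / z)" using z(1) by (simp add: zero_less_mult_iff)
    moreover from this have "G \<noteq> 0" by auto
    ultimately show ?thesis using True Re_complex_div_gt_0[of 1 "G / z"] by (simp add: Re_complex_div_gt_0)
  next
    case False
    then have *: "cmod (G / z - 1 / (2 * complex_of_real \<alpha>)) < 1 / (2 * \<alpha>)" using * by simp
    have "G / z \<noteq> 0"
    proof
      assume z0: "G / z = 0"
      show False using *[unfolded z0] \<alpha> by (simp add: norm_divide norm_mult)
    qed
    then show ?thesis using * disc_iff_Re_inverse[of "G / z" \<alpha>] False \<alpha> by simp
  qed
qed

text \<open>The three equations say that the cubic polynomials with constant term 1 and coefficients
  \<open>p1, p2, p3\<close> and \<open>q1, q2, q3\<close> are inverse to each other modulo
  \<open>\<zeta>^4\<close>, so the former approximates \<open>z / G z\<close>.\<close>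

lemma quotient_small_o:
  fixes G :: "complex \<Rightarrow> complex"
  assumes G: "G holomorphic_on ball 0 1"
    and exp: "small_o 4 (\<lambda>\<zeta>. G \<zeta> - \<zeta> * (1 + q1 * \<zeta> + q2 * \<zeta>^2 + q3 * \<zeta>^3))"
    and nz: "\<And>z. z \<noteq> 0 \<Longrightarrow> cmod z < 1 \<Longrightarrow> G z \<noteq> 0"
    and p1: "p1 + q1 = 0" and p2: "p2 + p1 * q1 + q2 = 0" and p3: "p3 + p2 * q1 + p1 * q2 + q3 = 0"
  defines "p \<equiv> \<lambda>z. if z = 0 then 1 else z / G z"
  shows "p holomorphic_on ball 0 1" "deriv p 0 = p1" "(deriv ^^ 3) p 0 = 6 * p3"
proof -
  define Q where "Q \<zeta> = \<zeta> * (1 + q1 * \<zeta> + q2 * \<zeta>^2 + q3 * \<zeta>^3)" for \<zeta>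
  define P where "P \<zeta> = 1 + p1 * \<zeta> + p2 * \<zeta>^2 + p3 * \<zeta>^3" for \<zeta>
  have Qd: "(Q has_field_derivative 1) (at 0)"
    unfolding Q_def by (auto intro!: derivative_eq_intros)
  have Qh: "Q holomorphic_on S" and Ph: "P holomorphic_on S" for S
    unfolding Q_def P_def by (intro holomorphic_intros)+
  have exp': "small_o 4 (\<lambda>\<zeta>. G \<zeta> - Q \<zeta>)" using exp by (simp add: Q_def)
  have G0: "G 0 = 0" using small_o_zero[OF exp'] by (simp add: Q_def)
  have "(deriv ^^ 1) (\<lambda>\<zeta>. G \<zeta> - Q \<zeta>) 0 = 0"
    by (rule small_o_higher_deriv[OF _ exp']) (auto intro!: holomorphic_intros G Qh)
  moreover have "deriv (\<lambda>\<zeta>. G \<zeta> - Q \<zeta>) 0 = deriv G 0 - deriv Q 0"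
    using G Qh[of "ball 0 1"] by (intro deriv_diff holomorphic_on_imp_differentiable_at[of _ "ball 0 1"]) auto
  ultimately have dG: "deriv G 0 = 1" using DERIV_imp_deriv[OF Qd] by simp
  \<comment> \<open>The singularity of \<open>G z / z\<close> at 0 is removable with value 1, so
    \<open>g\<close> is holomorphic without zeros and \<open>p = 1 / g\<close>.\<close>
  define g where "g z = (if z = 0 then deriv G 0 else (G z - G 0) / (z - 0))" for z
  have g: "g holomorphic_on ball 0 1"
    unfolding g_def by (rule pole_lemma[OF G]) simp
  have "g z \<noteq> 0" if "z \<in> ball 0 1" for z using that nz[of z] by (auto simp: g_def dG G0)
  then have "(\<lambda>z. 1 / g z) holomorphic_on ball 0 1" using g by (intro holomorphic_intros) auto
  moreover have pg: "(\<lambda>z. 1 / g z) = p" by (auto simp: g_def p_def dG G0)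
  ultimately show hol: "p holomorphic_on ball 0 1" by simp
  then have contp: "isCont p 0"
    by (intro continuous_on_interior[OF holomorphic_on_imp_continuous_on]) auto
  \<comment> \<open>\<open>s\<close> collects the terms of \<open>P * Q\<close> of degree at least
    5; those of degrees 2 to 4 vanish by the hypotheses.\<close>
  define s where "s \<zeta> = (p2 * q2 + p1 * q3 + p3 * q1) + (p3 * q2 + p2 * q3) * \<zeta> + p3 * q3 * \<zeta>^2" for \<zeta>
  have PQ: "P \<zeta> * Q \<zeta> = \<zeta> + \<zeta>^5 * s \<zeta>" for \<zeta>
  proof -
    have "P \<zeta> * Q \<zeta> = \<zeta> + \<zeta>^5 * s \<zeta> + (p1 + q1) * \<zeta>^2 + (p2 + p1 * q1 + q2) * \<zeta>^3
        + (p3 + p2 * q1 + p1 * q2 + q3) * \<zeta>^4"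
      unfolding P_def Q_def s_def by algebra
    then show ?thesis by (simp add: p1 p2 p3)
  qed
  have "small_o 4 (\<lambda>\<zeta>. (\<zeta> ^ Suc 4 * (- s \<zeta>)) *\<^sub>C (1::complex))"
    by (rule small_o_power) (auto simp: s_def intro!: continuous_intros)
  moreover have "small_o (4 + 0) (\<lambda>\<zeta>. (\<zeta> ^ 0 * (- P \<zeta>)) *\<^sub>C (G \<zeta> - Q \<zeta>))"
    by (rule small_o_scaleC[OF exp']) (auto simp: P_def intro!: continuous_intros)
  ultimately have "small_o 4 (\<lambda>\<zeta>. (\<zeta> ^ Suc 4 * (- s \<zeta>)) *\<^sub>C (1::complex) + (\<zeta> ^ 0 * (- P \<zeta>)) *\<^sub>C (G \<zeta> - Q \<zeta>))"
    by (intro small_o_add) auto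
  moreover have "(\<zeta> ^ Suc 4 * (- s \<zeta>)) *\<^sub>C (1::complex) + (\<zeta> ^ 0 * (- P \<zeta>)) *\<^sub>C (G \<zeta> - Q \<zeta>) = \<zeta> - P \<zeta> * G \<zeta>" for \<zeta>
    using PQ[of \<zeta>] by (simp add: algebra_simps power_Suc[symmetric] del: power_Suc)
  ultimately have PG: "small_o 4 (\<lambda>\<zeta>. \<zeta> - P \<zeta> * G \<zeta>)" by simp
  have "small_o (4 + 0) (\<lambda>\<zeta>. (\<zeta> ^ 0 * p \<zeta>) *\<^sub>C (\<zeta> - P \<zeta> * G \<zeta>))"
    by (rule small_o_scaleC[OF PG contp])
  then have o4: "small_o 4 (\<lambda>\<zeta>. p \<zeta> * (\<zeta> - P \<zeta> * G \<zeta>))" by simp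
  have o3: "small_o 3 (\<lambda>\<zeta>. p \<zeta> - P \<zeta>)"
    unfolding small_o_def
  proof (intro allI impI)
    fix e :: real assume e: "e > 0"
    have "\<forall>\<^sub>F \<zeta> in nhds 0. cmod \<zeta> < 1" unfolding eventually_nhds_metric by (intro exI[of _ 1]) auto
    with small_oD[OF o4 e] show "\<forall>\<^sub>F \<zeta> in nhds 0. cmod (p \<zeta> - P \<zeta>) \<le> e * cmod \<zeta> ^ 3"
    proof eventually_elim
      case (elim \<zeta>)
      show ?case
      proof (cases "\<zeta> = 0")
        case True then show ?thesis by (simp add: p_def P_def)
      next
        case False
        \<comment> \<open>Here \<open>p * G = \<zeta>\<close>; cancelling one factor
          \<open>\<zeta>\<close> lowers the order from 4 to 3.\<close>
        then have "p \<zeta> * (\<zeta> - P \<zeta> * G \<zeta>) = \<zeta> * (p \<zeta> - P \<zeta>)"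
          using nz[of \<zeta>] elim by (simp add: p_def field_simps)
        then have "cmod \<zeta> * cmod (p \<zeta> - P \<zeta>) \<le> cmod \<zeta> * (e * cmod \<zeta> ^ 3)"
          using elim by (simp add: norm_mult power_Suc[symmetric] eval_nat_numeral mult_ac)
        then show ?thesis using False by simp
      qed
    qed
  qed
  have dP: "deriv P = (\<lambda>\<zeta>. p1 + 2 * p2 * \<zeta> + 3 * p3 * \<zeta>^2)"
    unfolding P_def by (rule ext, rule DERIV_imp_deriv) (auto intro!: derivative_eq_intros)
  have ddP: "deriv (deriv P) = (\<lambda>\<zeta>. 2 * p2 + 6 * p3 * \<zeta>)"
    unfolding dP by (rule ext, rule DERIV_imp_deriv) (auto intro!: derivative_eq_intros)
  have dddP: "deriv (deriv (deriv P)) = (\<lambda>\<zeta>. 6 * p3)"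
    unfolding ddP by (rule ext, rule DERIV_imp_deriv) (auto intro!: derivative_eq_intros)
  have deriv_eq: "(deriv ^^ k) p 0 = (deriv ^^ k) P 0" if "k \<le> 3" for k
    using small_o_higher_deriv[OF holomorphic_on_diff[OF hol Ph] o3 that]
      higher_deriv_diff[OF hol Ph open_ball, of 0 k] by simp
  from deriv_eq[of 1] show "deriv p 0 = p1" by (simp add: dP)
  have "(deriv ^^ 3) P = deriv (deriv (deriv P))" by (simp add: numeral_3_eq_3)
  then show "(deriv ^^ 3) p 0 = 6 * p3" using deriv_eq[of 3] by (simp only: dddP)
qed

text \<open>Because the Taylor terms are radial, the vector \<open>w \<zeta>\<close> agrees with a
  scalar multiple of \<open>x\<close> up to fourth order, and \<open>T\<close> reads off that
  scalar.\<close>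

lemma J23_le_bound:
  fixes F :: "'a::complex_banach \<Rightarrow> 'a"
  assumes F: "locally_biholomorphic F" and H: "radial_expansion F H" and S: "F \<in> starlike_of_order \<alpha>"
    and x: "norm x = 1" and T: "T \<in> support_functionals x" and \<alpha>: "0 \<le> \<alpha>" "\<alpha> < 1"
  shows "cmod (J23 F x T) \<le> J23_bound \<alpha>"
proof -
  define a where "a = H 1 x"
  define b where "b = H 2 x"
  define c where "c = H 3 x"
  have T': "bounded_clinear T" "T x = 1" using T x by (auto simp: support_functionals_def)
  have rescale: "u = (of_real r * k) *\<^sub>C x" if "(1 / r) *\<^sub>R u = k *\<^sub>C x" "r \<noteq> 0" for u k and r :: real
  proof -
    have "u = r *\<^sub>R ((1 / r) *\<^sub>R u)" using that(2) by simp
    also have "\<dots> = (of_real r * k) *\<^sub>C x"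
      unfolding that(1) by (simp add: scaleC_of_real[symmetric] scaleC_scaleC)
    finally show ?thesis .
  qed
  have D2: "fderiv2_diag F 0 x = (2 * a) *\<^sub>C x"
    using rescale[of 2 "fderiv2_diag F 0 x" a] H by (simp add: radial_expansion_def a_def)
  have D3: "fderiv3_diag F 0 x = (6 * b) *\<^sub>C x"
    using rescale[of 6 "fderiv3_diag F 0 x" b] H by (simp add: radial_expansion_def b_def fact_numeral)
  have D4: "fderiv4_diag F 0 x = (24 * c) *\<^sub>C x"
    using rescale[of 24 "fderiv4_diag F 0 x" c] H by (simp add: radial_expansion_def c_def fact_numeral)
  have J: "J23 F x T = a * b - c"
    by (simp add: J23_def D2 D3 D4 bounded_clinearD(2)[OF T'(1)] T'(2) fact_numeral)
  have norm: "F 0 = 0" "fderiv F 0 x = x"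
    using S by (auto simp: starlike_of_order_def normalized_def)
  note hol = locally_biholomorphicD(1)[OF F]
  have x1: "norm x \<le> 1" using x by simp
  note expF = radial_line_expansion[OF hol x1 norm D2 D3 D4]
  have in_ball: "norm (z *\<^sub>C x) < 1" if "cmod z < 1" for z
    using that x by (simp add: norm_scaleC)
  define w where "w \<zeta> = inv (blinfun_apply (fderiv F (\<zeta> *\<^sub>C x))) (F (\<zeta> *\<^sub>C x))" for \<zeta>
  define G where "G \<zeta> = T (w \<zeta>)" for \<zeta>
  have G: "G holomorphic_on ball 0 1"
    unfolding holomorphic_on_def field_differentiable_def
  proof
    fix z :: complex assume "z \<in> ball 0 1"
    then obtain w' where "has_cderiv w w' z"
      using has_cderiv_inverse_line[OF F in_ball[of z]] unfolding w_def by auto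
    from has_cderiv_clinear[OF this T'(1)]
    have "(G has_field_derivative T w') (at z)" unfolding has_cderiv_complex[symmetric] G_def .
    then show "\<exists>f'. (G has_field_derivative f') (at z within ball 0 1)"
      using has_field_derivative_at_within by blast
  qed
  \<comment> \<open>These are the Taylor coefficients of \<open>f / (\<zeta> f')\<close> for the
    polynomial \<open>f\<close> with coefficients \<open>a, b, c\<close>; \<open>s\<close> is the
    remainder after extracting \<open>\<zeta>^5\<close>.\<close>
  define q1 where "q1 = - a"
  define q2 where "q2 = 2 * a^2 - 2 * b"
  define q3 where "q3 = 7 * a * b - 3 * c - 4 * a^3"
  define q where "q \<zeta> = 1 + q1 * \<zeta> + q2 * \<zeta>^2 + q3 * \<zeta>^3" for \<zeta>
  define s where "s \<zeta> = - (4 * c * q1 + 3 * b * q2 + 2 * a * q3) - (4 * c * q2 + 3 * b * q3) * \<zeta> - 4 * c * q3 * \<zeta>^2" for \<zeta>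
  let ?f = "\<lambda>\<zeta>. \<zeta> + a * \<zeta>^2 + b * \<zeta>^3 + c * \<zeta>^4"
  let ?f' = "\<lambda>\<zeta>. 1 + 2 * a * \<zeta> + 3 * b * \<zeta>^2 + 4 * c * \<zeta>^3"
  have fq: "?f \<zeta> - \<zeta> * q \<zeta> * ?f' \<zeta> = \<zeta> ^ Suc 4 * s \<zeta>" for \<zeta>
  proof -
    have "?f \<zeta> - \<zeta> * q \<zeta> * ?f' \<zeta> = \<zeta> ^ 5 * s \<zeta>"
      unfolding q_def s_def q1_def q2_def q3_def by algebra
    then show ?thesis by simp
  qed
  \<comment> \<open>Near 0 this is \<open>fderiv F (\<zeta> x)\<close> applied to the error
    \<open>w \<zeta> - \<zeta> q(\<zeta>) x\<close>.\<close>
  define E where "E \<zeta> = F (\<zeta> *\<^sub>C x) - (\<zeta> * q \<zeta>) *\<^sub>C fderiv F (\<zeta> *\<^sub>C x) x" for \<zeta>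
  have E: "small_o 4 E"
  proof -
    have "small_o (3 + 1) (\<lambda>\<zeta>. (\<zeta> ^ 1 * (- q \<zeta>)) *\<^sub>C (fderiv F (\<zeta> *\<^sub>C x) x - ?f' \<zeta> *\<^sub>C x))"
      by (rule small_o_scaleC[OF expF(2)]) (auto simp: q_def intro!: continuous_intros)
    moreover have "small_o 4 (\<lambda>\<zeta>. (\<zeta> ^ Suc 4 * s \<zeta>) *\<^sub>C x)"
      by (rule small_o_power) (auto simp: s_def intro!: continuous_intros)
    ultimately have "small_o 4 (\<lambda>\<zeta>. (F (\<zeta> *\<^sub>C x) - ?f \<zeta> *\<^sub>C x)
        + ((\<zeta> ^ 1 * (- q \<zeta>)) *\<^sub>C (fderiv F (\<zeta> *\<^sub>C x) x - ?f' \<zeta> *\<^sub>C x) + (\<zeta> ^ Suc 4 * s \<zeta>) *\<^sub>C x))"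
      by (intro small_o_add expF(1)) simp_all
    moreover have "(F (\<zeta> *\<^sub>C x) - ?f \<zeta> *\<^sub>C x)
        + ((\<zeta> ^ 1 * (- q \<zeta>)) *\<^sub>C (fderiv F (\<zeta> *\<^sub>C x) x - ?f' \<zeta> *\<^sub>C x) + (\<zeta> ^ Suc 4 * s \<zeta>) *\<^sub>C x) = E \<zeta>" for \<zeta>
      unfolding fq[symmetric] E_def
      by (simp only: scaleC.diff_left scaleC.diff_right scaleC_scaleC power_one_right mult_minus_right
          scaleC.minus_left) (simp add: scaleC.minus_left)
    ultimately show ?thesis by (simp only:)
  qed
  have "isCont (fderiv F) 0"
    by (rule has_derivative_continuous[OF holomorphic_on_ballD(1)[OF holomorphic_on_ball_fderiv[OF hol]]]) simp
  \<comment> \<open>The derivative at 0 is the identity, so the lower bound starts from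
    \<open>K = 1\<close>.\<close>
  moreover have "norm v \<le> 1 * norm (fderiv F 0 v)" for v
    using S by (simp add: starlike_of_order_def normalized_def)
  ultimately have low: "\<forall>\<^sub>F y in nhds 0. \<forall>v. norm v \<le> 2 * 1 * norm (fderiv F y v)"
    by (intro lower_bound_perturb) auto
  have "((\<lambda>\<zeta>. \<zeta> *\<^sub>C x) \<longlongrightarrow> 0 *\<^sub>C x) (nhds (0::complex))"
    by (intro scaleC.tendsto filterlim_ident tendsto_const)
  then have lim: "filterlim (\<lambda>\<zeta>. \<zeta> *\<^sub>C x) (nhds 0) (nhds (0::complex))" by simp
  have "small_o (4 + 0) (\<lambda>\<zeta>. w \<zeta> - (\<zeta> * q \<zeta>) *\<^sub>C x)"
  proof (rule small_o_bound[OF E, of 2])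
    have "\<forall>\<^sub>F \<zeta> in nhds (0::complex). cmod \<zeta> < 1"
      unfolding eventually_nhds_metric by (intro exI[of _ 1]) auto
    then show "\<forall>\<^sub>F \<zeta> in nhds 0. norm (w \<zeta> - (\<zeta> * q \<zeta>) *\<^sub>C x) \<le> 2 * cmod \<zeta> ^ 0 * norm (E \<zeta>)"
      using eventually_compose_filterlim[OF low lim]
    proof eventually_elim
      case (elim \<zeta>)
      have "fderiv F (\<zeta> *\<^sub>C x) (w \<zeta>) = F (\<zeta> *\<^sub>C x)"
        using in_ball[OF elim(1)] by (simp add: w_def bij_is_surj locally_biholomorphicD[OF F] surj_f_inv_f)
      then have "fderiv F (\<zeta> *\<^sub>C x) (w \<zeta> - (\<zeta> * q \<zeta>) *\<^sub>C x) = E \<zeta>"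
        by (simp add: blinfun.diff_right E_def
            bounded_clinearD(2)[OF holomorphic_on_ballD(2)[OF hol in_ball[OF elim(1)]]])
      then show ?case using elim(2)[rule_format, of "w \<zeta> - (\<zeta> * q \<zeta>) *\<^sub>C x"] by simp
    qed
  qed simp
  then have w4: "small_o 4 (\<lambda>\<zeta>. w \<zeta> - (\<zeta> * q \<zeta>) *\<^sub>C x)" by simp
  have "small_o (4 + 0) (\<lambda>\<zeta>. G \<zeta> - \<zeta> * q \<zeta>)"
  proof (rule small_o_bound[OF w4, of 1])
    have "cmod (G \<zeta> - \<zeta> * q \<zeta>) \<le> norm (w \<zeta> - (\<zeta> * q \<zeta>) *\<^sub>C x)" for \<zeta>
      using support_functional_norm_le[OF T, of "w \<zeta> - (\<zeta> * q \<zeta>) *\<^sub>C x"]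
      by (simp add: bounded_clinear_diff[OF T'(1)] bounded_clinearD(2)[OF T'(1)] T'(2) G_def)
    then show "\<forall>\<^sub>F \<zeta> in nhds 0. cmod (G \<zeta> - \<zeta> * q \<zeta>) \<le> 1 * cmod \<zeta> ^ 0 * norm (w \<zeta> - (\<zeta> * q \<zeta>) *\<^sub>C x)"
      by simp
  qed simp
  then have expG: "small_o 4 (\<lambda>\<zeta>. G \<zeta> - \<zeta> * (1 + q1 * \<zeta> + q2 * \<zeta>^2 + q3 * \<zeta>^3))"
    by (simp add: q_def)
  have star: "G z \<noteq> 0 \<and> \<alpha> < Re (z / G z)" if "z \<noteq> 0" "cmod z < 1" for z
    using starlike_of_orderD[OF S \<alpha>(1) x T that] by (simp add: G_def w_def)
  define p where "p z = (if z = 0 then 1 else z / G z)" for z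
  \<comment> \<open>Together with \<open>a\<close>, these are the Taylor coefficients of
    \<open>\<zeta> f' / f\<close>.\<close>
  define p2 where "p2 = 2 * b - a^2"
  define p3 where "p3 = 3 * c - 3 * a * b + a^3"
  have p: "p holomorphic_on ball 0 1" "deriv p 0 = a" "(deriv ^^ 3) p 0 = 6 * p3"
    unfolding p_def
    using quotient_small_o[OF G expG, of a p2 p3] star
    by (simp_all add: q1_def q2_def q3_def p2_def p3_def power2_eq_square power3_eq_cube algebra_simps)
  have "cmod (deriv p 0 ^ 3 - (deriv ^^ 3) p 0 / 6) \<le> 3 * J23_bound \<alpha>"
    by (rule cubic_coefficient_functional_bound[OF p(1)]) (use star \<alpha> in \<open>auto simp: p_def\<close>)
  moreover have "deriv p 0 ^ 3 - (deriv ^^ 3) p 0 / 6 = a ^ 3 - p3"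
    by (simp add: p)
  moreover have "a ^ 3 - p3 = 3 * (a * b - c)"
    by (simp add: p3_def algebra_simps)
  ultimately show ?thesis by (simp add: J norm_mult del: right_diff_distrib_numeral)
qed

section \<open>Extremal maps\<close>

text \<open>For a curve known to run in one complex direction \<open>y\<close>, uniqueness of the
  derivative reduces its computation to scalar calculus.\<close>

lemma has_cderiv_scaleC_unique:
  assumes u: "has_cderiv u u' z" and z: "cmod z < \<rho>"
    and eq: "\<And>\<zeta>. cmod \<zeta> < \<rho> \<Longrightarrow> u \<zeta> = \<phi> \<zeta> *\<^sub>C y"
    and \<phi>: "(\<phi> has_field_derivative \<phi>') (at z)"
  shows "u' = \<phi>' *\<^sub>C (y::'b::complex_normed_vector)"
proof -
  have "has_cderiv u (\<phi>' *\<^sub>C y) z"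
    by (rule has_derivative_transform_within_open[OF has_cderiv_scaleC[OF \<phi>, of y], of "ball 0 \<rho>"])
      (use z eq in auto)
  from has_derivative_unique[OF u this] have "1 *\<^sub>C u' = 1 *\<^sub>C (\<phi>' *\<^sub>C y)" by metis
  then show ?thesis by simp
qed

text \<open>\<open>f i\<close> stands for the \<open>i\<close>-th derivative of
  \<open>\<Psi> = f 0\<close>, up to order 4. \<open>Re_gt\<close> says that
  \<open>\<zeta> \<Psi>(\<zeta>)\<close> is starlike of order \<open>\<alpha>\<close> on the unit
  disc.\<close>

locale radial_map =
  fixes T :: "'a::complex_banach \<Rightarrow> complex" and f :: "nat \<Rightarrow> complex \<Rightarrow> complex" and \<alpha> :: real
  assumes T: "bounded_clinear T" and T_le: "\<And>x. cmod (T x) \<le> norm x"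
    and deriv_f: "\<And>i z. i < 4 \<Longrightarrow> cmod z < 1 \<Longrightarrow> (f i has_field_derivative f (Suc i) z) (at z)"
    and f_0: "f 0 0 = 1"
    and f_nonzero: "\<And>z. cmod z < 1 \<Longrightarrow> f 0 z \<noteq> 0"
    and Re_gt: "\<And>z. cmod z < 1 \<Longrightarrow> \<alpha> < Re (1 + z * f 1 z / f 0 z)"
    and \<alpha>: "0 \<le> \<alpha>"
begin

definition F :: "'a \<Rightarrow> 'a" where
  "F x = f 0 (T x) *\<^sub>C x"

lemma T_less: "norm x < 1 \<Longrightarrow> cmod (T x) < 1"
  using T_le[of x] by simp

lemma has_derivative_F:
  assumes x: "norm x < 1"
  shows "(F has_derivative (\<lambda>h. f 0 (T x) *\<^sub>C h + (f 1 (T x) * T h) *\<^sub>C x)) (at x)"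
proof -
  have "(f 0 has_derivative (\<lambda>h. h * f 1 (T x))) (at (T x))"
    by (rule has_derivative_eq_rhs[OF has_field_derivative_imp_has_derivative[OF deriv_f]])
      (use T_less[OF x] in \<open>auto simp: mult.commute\<close>)
  from has_derivative_compose[OF bounded_linear_imp_has_derivative[OF bounded_clinearD(1)[OF T]] this]
  have "((\<lambda>x. f 0 (T x)) has_derivative (\<lambda>h. T h * f 1 (T x))) (at x)" .
  from scaleC.FDERIV[OF this has_derivative_ident] show ?thesis
    unfolding F_def[abs_def] by (simp add: mult.commute)
qed

lemma bounded_clinear_derivative:
  "bounded_clinear (\<lambda>h. a *\<^sub>C h + (b * T h) *\<^sub>C x)"
  unfolding bounded_clinear_def
proof (intro conjI allI)
  show "bounded_linear (\<lambda>h. a *\<^sub>C h + (b * T h) *\<^sub>C x)"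
    by (intro bounded_linear_add scaleC.bounded_linear_right
        bounded_linear_compose[OF scaleC.bounded_linear_left]
        bounded_linear_const_mult bounded_clinearD(1)[OF T])
  show "a *\<^sub>C c *\<^sub>C h + (b * T (c *\<^sub>C h)) *\<^sub>C x = c *\<^sub>C (a *\<^sub>C h + (b * T h) *\<^sub>C x)" for c h
    by (simp add: bounded_clinearD(2)[OF T] scaleC_add_right scaleC_scaleC mult_ac)
qed

lemma holomorphic_F: "holomorphic_on_ball F"
  unfolding holomorphic_on_ball_def
  by (rule ballI, rule exI, rule conjI, rule bounded_clinear_derivative, rule has_derivative_F) simp

lemma fderiv_F:
  assumes "norm x < 1"
  shows "blinfun_apply (fderiv F x) = (\<lambda>h. f 0 (T x) *\<^sub>C h + (f 1 (T x) * T h) *\<^sub>C x)"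
  by (rule fderiv_eq[OF has_derivative_F[OF assms]])

lemma denominator_nonzero:
  assumes "cmod z < 1" shows "f 0 z + z * f 1 z \<noteq> 0"
proof
  assume "f 0 z + z * f 1 z = 0"
  then have "1 + z * f 1 z / f 0 z = 0" using f_nonzero[OF assms] by (simp add: field_simps)
  then show False using Re_gt[OF assms] \<alpha> by simp
qed

text \<open>A multiple of the identity plus an operator of rank at most one is inverted by the
  Sherman-Morrison formula \<open>B\<close>. As \<open>A x = m x\<close>, the inverse sends
  \<open>F x = a x\<close> to \<open>(a / m) x\<close>.\<close>

lemma inverse_derivative:
  assumes x: "norm x < 1"
  defines "A \<equiv> blinfun_apply (fderiv F x)"
  shows "bij A" "bounded_linear (inv A)" "inv A (F x) = (f 0 (T x) / (f 0 (T x) + T x * f 1 (T x))) *\<^sub>C x"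
proof -
  define a where "a = f 0 (T x)"
  define b where "b = f 1 (T x)"
  define m where "m = a + T x * b"
  define B where "B y = (1 / a) *\<^sub>C (y + ((- b / m) * T y) *\<^sub>C x)" for y
  have A: "A h = a *\<^sub>C h + (b * T h) *\<^sub>C x" for h
    by (simp add: A_def fderiv_F[OF x] a_def b_def)
  have a: "a \<noteq> 0" using f_nonzero[OF T_less[OF x]] by (simp add: a_def)
  have m: "m \<noteq> 0" using denominator_nonzero[OF T_less[OF x]] by (simp add: m_def a_def b_def)
  have Tadd: "T (u + v) = T u + T v" and Tscale: "T (c *\<^sub>C u) = c * T u" for u v c
    using bounded_clinearD[OF T] by (auto simp: bounded_linear.linear linear_add)
  have "T (A h) = m * T h" for h
    by (simp add: A Tadd Tscale m_def algebra_simps)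
  then have BA: "B (A h) = h" for h
    using a m by (simp add: B_def A scaleC_add_right scaleC_scaleC scaleC_add_left[symmetric] add.assoc)
  have TB: "T (B y) = T y / m" for y
  proof -
    have "T (B y) = (T y - b * T y * T x / m) / a" by (simp add: B_def Tadd Tscale)
    also have "\<dots> = T y * (m - b * T x) / (m * a)" using m by (simp add: field_simps)
    also have "m - b * T x = a" by (simp add: m_def)
    finally show ?thesis using a by simp
  qed
  have AB: "A (B y) = y" for y
  proof -
    have "A (B y) = y + ((- b / m) * T y) *\<^sub>C x + (b * (T y / m)) *\<^sub>C x"
      unfolding A TB using a by (simp add: B_def scaleC_scaleC)
    also have "\<dots> = y + ((- b / m) * T y + b * (T y / m)) *\<^sub>C x"
      by (simp only: scaleC_add_left add.assoc)
    finally show ?thesis by simp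
  qed
  show bij: "bij A" by (rule o_bij[of B]) (auto simp: fun_eq_iff AB BA)
  have "inv A = B" by (rule inv_equality) (auto simp: AB BA)
  moreover have "bounded_linear B"
    unfolding B_def
    by (intro bounded_linear_compose[OF scaleC.bounded_linear_right] bounded_linear_add bounded_linear_ident
        bounded_linear_compose[OF scaleC.bounded_linear_left]
        bounded_linear_const_mult bounded_clinearD(1)[OF T])
  ultimately show "bounded_linear (inv A)" by simp
  have "A ((a / m) *\<^sub>C x) = (a * (a / m) + b * (a / m * T x)) *\<^sub>C x"
    by (simp only: A Tscale scaleC_scaleC scaleC_add_left)
  also have "a * (a / m) + b * (a / m * T x) = a"
    using m by (simp add: divide_simps) (simp add: m_def algebra_simps)
  finally have "A ((a / m) *\<^sub>C x) = F x" by (simp add: F_def a_def)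
  then have "inv A (F x) = (a / m) *\<^sub>C x"
    by (intro inv_f_eq bij_is_inj[OF bij])
  then show "inv A (F x) = (f 0 (T x) / (f 0 (T x) + T x * f 1 (T x))) *\<^sub>C x"
    by (simp add: a_def m_def b_def)
qed

lemma locally_biholomorphic_F: "locally_biholomorphic F"
  unfolding locally_biholomorphic_def using holomorphic_F inverse_derivative by auto

text \<open>The inverse derivative sends \<open>F x\<close> to \<open>\<kappa> x\<close>, so every
  support functional of \<open>x\<close> gives \<open>\<kappa> * norm x\<close>, and
  \<open>1 / \<kappa>\<close> is the quantity in \<open>Re_gt\<close> at \<open>T x\<close>.\<close>

lemma starlike_F: "F \<in> starlike_of_order \<alpha>"
proof -
  have T0: "T 0 = 0" using bounded_clinearD(2)[OF T, of 0 0] by simp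
  have "normalized F"
    unfolding normalized_def
    by (auto simp: F_def scaleC.zero_right fderiv_F T0 f_0 intro!: blinfun_eqI)
  moreover have "if \<alpha> = 0 then Re (S (inv (blinfun_apply (fderiv F x)) (F x))) > 0
            else cmod (1 / complex_of_real (norm x) * S (inv (blinfun_apply (fderiv F x)) (F x))
                       - 1 / (2 * complex_of_real \<alpha>)) < 1 / (2 * \<alpha>)"
    if x: "x \<in> ball 0 1 - {0}" and S: "S \<in> support_functionals x" for x S
  proof -
    have nx: "norm x < 1" "x \<noteq> 0" using x by auto
    define z where "z = T x"
    have z: "cmod z < 1" using T_less[OF nx(1)] by (simp add: z_def)
    define \<kappa> where "\<kappa> = f 0 z / (f 0 z + z * f 1 z)"
    have \<kappa>: "\<kappa> \<noteq> 0" using f_nonzero[OF z] denominator_nonzero[OF z] by (simp add: \<kappa>_def)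
    have "1 / \<kappa> = 1 + z * f 1 z / f 0 z" using f_nonzero[OF z] by (simp add: \<kappa>_def field_simps)
    then have Re: "\<alpha> < Re (1 / \<kappa>)" using Re_gt[OF z] by simp
    have S_val: "S (inv (blinfun_apply (fderiv F x)) (F x)) = \<kappa> * norm x"
      using S inverse_derivative(3)[OF nx(1)]
      by (simp add: support_functionals_def bounded_clinear_def \<kappa>_def z_def)
    show ?thesis
    proof (cases "\<alpha> = 0")
      case True
      have "0 < Re \<kappa>" using Re \<kappa> True by (simp add: Re_complex_div_gt_0)
      then show ?thesis using True nx by (simp add: S_val)
    next
      case False
      have "1 / complex_of_real (norm x) * (\<kappa> * norm x) = \<kappa>" using nx by simp
      then show ?thesis
        unfolding S_val using disc_iff_Re_inverse[OF \<kappa>, of \<alpha>] Re False \<alpha> by simp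
    qed
  qed
  ultimately show ?thesis
    unfolding starlike_of_order_def using locally_biholomorphic_F by blast
qed

section \<open>Taylor data of the radial map at the origin\<close>

lemma homogeneous_polynomial_power: "homogeneous_polynomial k (\<lambda>x. c * T x ^ k)"
  unfolding homogeneous_polynomial_def
proof (intro exI conjI allI)
  define L where "L xs = c * prod_list (map T xs)" for xs
  show "c * T x ^ k = L (replicate k x)" for x
    by (simp add: L_def map_replicate prod_list_replicate)
  have prod_le: "cmod (prod_list (map T xs)) \<le> prod_list (map norm xs)" for xs
    by (induction xs) (auto simp: norm_mult T_le intro!: mult_mono prod_list_nonneg)
  show "bounded_cmultilinear k L"
    unfolding bounded_cmultilinear_def
  proof (intro conjI allI impI exI[of _ "cmod c"])
    fix xs :: "'a list" and i assume xs: "length xs = k" "i < k"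
    have "L (xs[i := x]) = (c * prod_list (map T (take i xs)) * prod_list (map T (drop (Suc i) xs))) * T x" for x
      using xs by (simp add: L_def upd_conv_take_nth_drop mult_ac)
    moreover have "bounded_clinear (\<lambda>x. d * T x)" for d
      using bounded_linear_const_mult[OF bounded_clinearD(1)[OF T], of d]
      by (simp add: bounded_clinear_def bounded_clinearD(2)[OF T])
    ultimately show "bounded_clinear (\<lambda>x. L (xs[i := x]))" by simp
  next
    fix xs :: "'a list"
    show "cmod (L xs) \<le> cmod c * prod_list (map norm xs)"
      unfolding L_def norm_mult by (intro mult_left_mono prod_le) simp
  qed
qed

text \<open>On the line through \<open>x\<close> the map is
  \<open>\<zeta> \<Psi>(\<sigma> \<zeta>) x\<close>, so each iterated derivative in turn is a scalar
  multiple of \<open>x\<close>; the factors 2, 3, 4 come from the Leibniz rule.\<close>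

lemma diag_derivatives:
  "fderiv2_diag F 0 x = (2 * f 1 0 * T x) *\<^sub>C x"
  "fderiv3_diag F 0 x = (3 * f 2 0 * T x ^ 2) *\<^sub>C x"
  "fderiv4_diag F 0 x = (4 * f 3 0 * T x ^ 3) *\<^sub>C x"
proof -
  define \<sigma> where "\<sigma> = T x"
  \<comment> \<open>\<open>x\<close> is arbitrary here; this radius keeps \<open>\<zeta> x\<close>
    in the unit ball.\<close>
  define \<rho> where "\<rho> = 1 / (norm x + 1)"
  have "norm x + 1 > 0" by (simp add: add_nonneg_pos)
  then have \<rho>: "\<rho> > 0" by (simp add: \<rho>_def)
  have in_ball: "norm (\<zeta> *\<^sub>C x) < 1" if "cmod \<zeta> < \<rho>" for \<zeta>
  proof -
    have "cmod \<zeta> * (norm x + 1) < 1" using that \<open>norm x + 1 > 0\<close> by (simp add: \<rho>_def pos_less_divide_eq)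
    then show ?thesis using norm_ge_zero[of \<zeta>] unfolding norm_scaleC distrib_left by linarith
  qed
  note der = has_cderiv_iterated_line[OF holomorphic_F in_ball]
  have T\<zeta>: "T (\<zeta> *\<^sub>C x) = \<sigma> * \<zeta>" for \<zeta> by (simp add: bounded_clinearD(2)[OF T] \<sigma>_def)
  have small: "cmod (\<sigma> * \<zeta>) < 1" if "cmod \<zeta> < \<rho>" for \<zeta>
    using T_less[OF in_ball[OF that]] by (simp add: T\<zeta>)
  have df: "((\<lambda>\<zeta>. f i (\<sigma> * \<zeta>)) has_field_derivative (\<sigma> * f (Suc i) (\<sigma> * z))) (at z)"
    if "i < 4" "cmod z < \<rho>" for i z
  proof -
    have "((\<lambda>\<zeta>. \<sigma> * \<zeta>) has_field_derivative \<sigma>) (at z)" by (auto intro!: derivative_eq_intros)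
    from DERIV_chain2[OF deriv_f[OF that(1) small[OF that(2)]] this] show ?thesis by (simp add: mult.commute)
  qed
  have d0: "((\<lambda>\<zeta>. \<zeta> * f 0 (\<sigma> * \<zeta>)) has_field_derivative (f 0 (\<sigma> * z) + \<sigma> * z * f 1 (\<sigma> * z))) (at z)"
    if "cmod z < \<rho>" for z
    using DERIV_mult[OF DERIV_ident df[of 0 z]] that by (simp add: mult_ac add.commute)
  have d1: "((\<lambda>\<zeta>. f 0 (\<sigma> * \<zeta>) + \<sigma> * \<zeta> * f 1 (\<sigma> * \<zeta>)) has_field_derivative
      (2 * \<sigma> * f 1 (\<sigma> * z) + \<sigma>^2 * z * f 2 (\<sigma> * z))) (at z)" if "cmod z < \<rho>" for z
    by (rule derivative_eq_intros df that refl | simp)+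
      (simp add: algebra_simps power2_eq_square numeral_2_eq_2)
  have d2: "((\<lambda>\<zeta>. 2 * \<sigma> * f 1 (\<sigma> * \<zeta>) + \<sigma>^2 * \<zeta> * f 2 (\<sigma> * \<zeta>)) has_field_derivative
      (3 * \<sigma>^2 * f 2 (\<sigma> * z) + \<sigma>^3 * z * f 3 (\<sigma> * z))) (at z)" if "cmod z < \<rho>" for z
    by (rule derivative_eq_intros df that refl | simp)+
      (simp add: algebra_simps power2_eq_square power3_eq_cube numeral_2_eq_2 numeral_3_eq_3)
  have d3: "((\<lambda>\<zeta>. 3 * \<sigma>^2 * f 2 (\<sigma> * \<zeta>) + \<sigma>^3 * \<zeta> * f 3 (\<sigma> * \<zeta>)) has_field_derivative
      (4 * \<sigma>^3 * f 3 0)) (at 0)"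
    by (rule derivative_eq_intros df \<rho> refl | simp add: \<rho>)+
      (simp add: algebra_simps power2_eq_square power3_eq_cube numeral_2_eq_2 numeral_3_eq_3)
  have e0: "F (\<zeta> *\<^sub>C x) = (\<zeta> * f 0 (\<sigma> * \<zeta>)) *\<^sub>C x" if "cmod \<zeta> < \<rho>" for \<zeta>
    by (simp add: F_def T\<zeta> scaleC_scaleC mult.commute)
  have e1: "fderiv F (\<zeta> *\<^sub>C x) x = (f 0 (\<sigma> * \<zeta>) + \<sigma> * \<zeta> * f 1 (\<sigma> * \<zeta>)) *\<^sub>C x" if "cmod \<zeta> < \<rho>" for \<zeta>
    by (rule has_cderiv_scaleC_unique[OF der(1)[OF that] that e0 d0[OF that]])
  have e2: "fderiv2_diag F (\<zeta> *\<^sub>C x) x = (2 * \<sigma> * f 1 (\<sigma> * \<zeta>) + \<sigma>^2 * \<zeta> * f 2 (\<sigma> * \<zeta>)) *\<^sub>C x"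
    if "cmod \<zeta> < \<rho>" for \<zeta>
    unfolding fderiv2_diag_def
    by (rule has_cderiv_scaleC_unique[OF der(2)[OF that] that e1 d1[OF that]])
  have e3: "fderiv3_diag F (\<zeta> *\<^sub>C x) x = (3 * \<sigma>^2 * f 2 (\<sigma> * \<zeta>) + \<sigma>^3 * \<zeta> * f 3 (\<sigma> * \<zeta>)) *\<^sub>C x"
    if "cmod \<zeta> < \<rho>" for \<zeta>
    by (rule has_cderiv_scaleC_unique[OF der(3)[OF that] that e2 d2[OF that]])
  have "cmod 0 < \<rho>" using \<rho> by simp
  have "fderiv4_diag F (0 *\<^sub>C x) x = (4 * \<sigma>^3 * f 3 0) *\<^sub>C x"
    by (rule has_cderiv_scaleC_unique[OF der(4)[OF \<open>cmod 0 < \<rho>\<close>] \<open>cmod 0 < \<rho>\<close> e3 d3])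
  then show "fderiv4_diag F 0 x = (4 * f 3 0 * T x ^ 3) *\<^sub>C x" by (simp add: \<sigma>_def mult_ac)
  show "fderiv2_diag F 0 x = (2 * f 1 0 * T x) *\<^sub>C x"
    using e2[OF \<open>cmod 0 < \<rho>\<close>] by (simp add: \<sigma>_def mult_ac)
  show "fderiv3_diag F 0 x = (3 * f 2 0 * T x ^ 2) *\<^sub>C x"
    using e3[OF \<open>cmod 0 < \<rho>\<close>] by (simp add: \<sigma>_def mult_ac)
qed

lemma radial_expansion_F: "radial_expansion F (\<lambda>k x. (f k 0 / fact k) * T x ^ k)"
  unfolding radial_expansion_def
proof (intro conjI)
  show "\<forall>k\<in>{1, 2, 3}. homogeneous_polynomial k (\<lambda>x. (f k 0 / fact k) * T x ^ k)"
    using homogeneous_polynomial_power by blast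
qed (simp_all add: diag_derivatives scaleC_of_real[symmetric] scaleC_scaleC fact_numeral)

lemma J23_F:
  assumes "T x = 1"
  shows "J23 F x T = f 1 0 * f 2 0 / 2 - f 3 0 / 6"
  by (simp add: J23_def diag_derivatives assms bounded_clinearD(2)[OF T] fact_numeral)

end

text \<open>\<open>w / (1 - w)\<close> maps the unit disc into the half-plane
  \<open>Re > - 1 / 2\<close>, and \<open>1 - w\<close> stays in the right half-plane, where
  \<open>Ln\<close> is holomorphic.\<close>

lemma two_atom_kernel:
  fixes s :: complex
  assumes s: "cmod s = 1" and z: "cmod z < 1"
  shows "1 - s * z \<noteq> 0" "1 - s * z \<notin> \<real>\<^sub>\<le>\<^sub>0" "- 1 / 2 < Re (s * z / (1 - s * z))"
proof -
  define w where "w = s * z"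
  have w: "cmod w < 1" using s z by (simp add: w_def norm_mult)
  then have Re: "0 < Re (1 - w)" using complex_Re_le_cmod[of w] by simp
  then have "1 - w \<noteq> 0" "1 - w \<notin> \<real>\<^sub>\<le>\<^sub>0"
    by (auto simp: complex_nonpos_Reals_iff)
  then show nz: "1 - s * z \<noteq> 0" and "1 - s * z \<notin> \<real>\<^sub>\<le>\<^sub>0"
    unfolding w_def by blast+
  have "(cmod (1 - w))\<^sup>2 = 1 - 2 * Re w + (cmod w)\<^sup>2"
    unfolding cmod_power2 by (simp add: power2_eq_square algebra_simps)
  moreover have "(cmod w)\<^sup>2 < 1" using w by (simp add: power_less_one_iff abs_square_less_1)
  moreover have pos: "0 < (cmod (1 - w))\<^sup>2" using nz by (simp add: w_def)
  ultimately have "(cmod (1 - w))\<^sup>2 < 2 * Re (1 - w)" by simp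
  then have "1 / 2 < Re (1 - w) / (cmod (1 - w))\<^sup>2" using pos by (simp add: field_simps)
  also have "\<dots> = Re (1 / (1 - w))" by (simp add: Re_divide cmod_power2)
  also have "1 / (1 - w) = 1 + w / (1 - w)" using nz by (simp add: w_def field_simps)
  finally show "- 1 / 2 < Re (s * z / (1 - s * z))" by (simp add: w_def)
qed

text \<open>The scalar factor is \<open>((1 - s z) (1 - c z)) ^ (- \<beta>)\<close>, where the
  common real part \<open>t\<close> of the conjugate atoms \<open>s\<close>, \<open>c\<close>
  maximises the cubic. For \<open>t = 1\<close> they coincide, and the disc function is
  \<open>z / (1 - z) ^ (2 * \<beta>)\<close>.\<close>

lemma extremal_map_exists:
  fixes x0 :: "'a::complex_banach"
  assumes x0: "norm x0 = 1" and T: "T \<in> support_functionals x0" and \<alpha>: "0 \<le> \<alpha>" "\<alpha> < 1"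
  obtains F H where "locally_biholomorphic F" "radial_expansion F H" "F \<in> starlike_of_order \<alpha>"
    "cmod (J23 F x0 T) = J23_bound \<alpha>"
proof -
  define \<beta> where "\<beta> = 1 - \<alpha>"
  obtain t where t: "0 \<le> t" "t \<le> 1"
    and att: "2 * \<beta> * (3 * t - (4 - 4 * \<beta>\<^sup>2) * t ^ 3) = 3 * J23_bound (1 - \<beta>)"
    using extremal_cubic_attained[of \<beta>] \<alpha> by (auto simp: \<beta>_def)
  define s where "s = Complex t (sqrt (1 - t\<^sup>2))"
  define c where "c = cnj s"
  have t2: "t\<^sup>2 \<le> 1" using t by (simp add: power_le_one)
  have s: "cmod s = 1" using t2 by (simp add: s_def complex_norm)
  then have c: "cmod c = 1" by (simp add: c_def)
  have sum: "s + c = 2 * complex_of_real t" by (simp add: s_def c_def complex_eq_iff)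
  have prod: "s * c = 1" using complex_norm_square[of s] s by (simp add: c_def)
  define \<Psi> where "\<Psi> z = exp (- \<beta> * (Ln (1 - s * z) + Ln (1 - c * z)))" for z
  \<comment> \<open>\<open>R 0\<close> is the logarithmic derivative of \<open>\<Psi>\<close>, and
    \<open>R k\<close> is its \<open>k\<close>-th derivative.\<close>
  define R where "R k z = \<beta> * fact k * ((s / (1 - s * z)) ^ Suc k + (c / (1 - c * z)) ^ Suc k)" for k z
  \<comment> \<open>The product rule makes every derivative of \<open>\<Psi>\<close> a polynomial in
    the \<open>R k\<close> times \<open>\<Psi>\<close>; the last entry is the derivative of
    \<open>f 3\<close>.\<close>
  define f where "f i z = [\<Psi> z, R 0 z * \<Psi> z, (R 1 z + R 0 z ^ 2) * \<Psi> z,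
      (R 2 z + 3 * R 0 z * R 1 z + R 0 z ^ 3) * \<Psi> z,
      ((R 3 z + 3 * R 1 z ^ 2 + 3 * R 0 z * R 2 z + 3 * R 0 z ^ 2 * R 1 z)
        + (R 2 z + 3 * R 0 z * R 1 z + R 0 z ^ 3) * R 0 z) * \<Psi> z] ! i" for i z
  note ks = two_atom_kernel[OF s] and kc = two_atom_kernel[OF c]
  have d\<Psi>: "(\<Psi> has_field_derivative R 0 z * \<Psi> z) (at z)" if "cmod z < 1" for z
  proof -
    have "((\<lambda>z. Ln (1 - u * z)) has_field_derivative - (u / (1 - u * z))) (at z)"
      if "1 - u * z \<notin> \<real>\<^sub>\<le>\<^sub>0" for u
      by (rule derivative_eq_intros refl that | simp)+ (simp add: divide_inverse mult.commute)
    note dL = this[OF ks(2)[OF that]] this[OF kc(2)[OF that]]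
    show ?thesis
      unfolding \<Psi>_def
      by (rule DERIV_cong[OF DERIV_chain2[OF DERIV_exp DERIV_cmult[OF DERIV_add[OF dL]]]])
        (simp add: R_def algebra_simps)
  qed
  have dq: "((\<lambda>z. u / (1 - u * z)) has_field_derivative (u / (1 - u * z)) ^ 2) (at z)"
    if "1 - u * z \<noteq> 0" for u z :: complex
    by (rule derivative_eq_intros refl that | simp)+ (simp add: power2_eq_square)
  have dpow: "((\<lambda>z. (u / (1 - u * z)) ^ Suc k) has_field_derivative
      of_nat (Suc k) * (u / (1 - u * z)) ^ k * (u / (1 - u * z)) ^ 2) (at z)"
    if "1 - u * z \<noteq> 0" for u z :: complex and k
    by (rule DERIV_cong[OF DERIV_power[OF dq[OF that]]]) (simp add: mult_ac)
  have dR: "(R k has_field_derivative R (Suc k) z) (at z)" if "cmod z < 1" for k z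
  proof -
    have "(R k has_field_derivative \<beta> * fact k *
      (of_nat (Suc k) * (s / (1 - s * z)) ^ k * (s / (1 - s * z)) ^ 2
       + of_nat (Suc k) * (c / (1 - c * z)) ^ k * (c / (1 - c * z)) ^ 2)) (at z)"
      unfolding R_def
      by (intro DERIV_cmult DERIV_add dpow ks(1) kc(1) that)
    moreover have "\<beta> * fact k *
      (of_nat (Suc k) * (s / (1 - s * z)) ^ k * (s / (1 - s * z)) ^ 2
       + of_nat (Suc k) * (c / (1 - c * z)) ^ k * (c / (1 - c * z)) ^ 2) = R (Suc k) z"
      unfolding R_def by (simp only: fact_Suc power_add[symmetric] power_Suc power2_eq_square
          of_nat_mult of_real_mult of_real_of_nat_eq mult_ac distrib_left)
    ultimately show ?thesis by simp
  qed
  have df: "(f i has_field_derivative f (Suc i) z) (at z)" if i: "i < 4" and z: "cmod z < 1" for i z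
  proof -
    note d\<Psi> = d\<Psi>[OF z]
    have dR0: "(R 0 has_field_derivative R 1 z) (at z)" using dR[OF z, of 0] by simp
    have dR1: "(R 1 has_field_derivative R 2 z) (at z)" using dR[OF z, of 1] by (simp add: numeral_2_eq_2)
    have dR2: "(R 2 has_field_derivative R 3 z) (at z)" using dR[OF z, of 2] by simp
    note d = d\<Psi> dR0 dR1 dR2
    have "i = 0 \<or> i = 1 \<or> i = 2 \<or> i = 3" using i by auto
    then show ?thesis
    proof (elim disjE)
      assume "i = 0"
      then show ?thesis unfolding f_def using d(1) by simp
    next
      assume i: "i = 1"
      have "((\<lambda>z. R 0 z * \<Psi> z) has_field_derivative (R 1 z + R 0 z ^ 2) * \<Psi> z) (at z)"
        by (rule DERIV_cong[OF DERIV_mult[OF d(2,1)]]) (simp add: power2_eq_square algebra_simps)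
      then show ?thesis unfolding f_def i by simp
    next
      assume i: "i = 2"
      have "((\<lambda>z. (R 1 z + R 0 z ^ 2) * \<Psi> z) has_field_derivative
          (R 2 z + 3 * R 0 z * R 1 z + R 0 z ^ 3) * \<Psi> z) (at z)"
        by (rule derivative_eq_intros d refl)+
          (simp add: power2_eq_square power3_eq_cube algebra_simps)
      then show ?thesis unfolding f_def i by simp
    next
      assume i: "i = 3"
      have "((\<lambda>z. (R 2 z + 3 * R 0 z * R 1 z + R 0 z ^ 3) * \<Psi> z) has_field_derivative
          ((R 3 z + 3 * R 1 z ^ 2 + 3 * R 0 z * R 2 z + 3 * R 0 z ^ 2 * R 1 z)
            + (R 2 z + 3 * R 0 z * R 1 z + R 0 z ^ 3) * R 0 z) * \<Psi> z) (at z)"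
        by (rule derivative_eq_intros d refl)+
          (simp add: power2_eq_square power3_eq_cube algebra_simps)
      then show ?thesis unfolding f_def i by simp
    qed
  qed
  interpret radial: radial_map T f \<alpha>
  proof
    show "bounded_clinear T" using T by (simp add: support_functionals_def)
    show "cmod (T x) \<le> norm x" for x by (rule support_functional_norm_le[OF T])
    show "(f i has_field_derivative f (Suc i) z) (at z)" if "i < 4" "cmod z < 1" for i z
      by (rule df[OF that])
    show "f 0 0 = 1" by (simp add: f_def \<Psi>_def)
    show "f 0 z \<noteq> 0" for z by (simp add: f_def \<Psi>_def)
    show "0 \<le> \<alpha>" by fact
    fix z :: complex assume z: "cmod z < 1"
    have "z * f 1 z / f 0 z = \<beta> * (s * z / (1 - s * z) + c * z / (1 - c * z))"
      by (simp add: f_def R_def \<Psi>_def field_simps)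
    then have "Re (z * f 1 z / f 0 z) = \<beta> * (Re (s * z / (1 - s * z)) + Re (c * z / (1 - c * z)))"
      by simp
    also have "\<dots> > \<beta> * (- 1)"
      using ks(3)[OF z] kc(3)[OF z] \<alpha> by (intro mult_strict_left_mono) (auto simp: \<beta>_def)
    finally show "\<alpha> < Re (1 + z * f 1 z / f 0 z)" by (simp add: \<beta>_def)
  qed
  have Tx: "T x0 = 1" using T x0 by (simp add: support_functionals_def)
  have R0: "R 0 0 = of_real (2 * \<beta> * t)"
    using sum by (simp add: R_def) 
  \<comment> \<open>Newton's identity: \<open>s + c = 2 t\<close> and \<open>s c = 1\<close>
    determine the third power sum.\<close>
  have "s ^ 3 + c ^ 3 = (s + c) ^ 3 - 3 * (s * c) * (s + c)" by algebra
  then have cubes: "s ^ 3 + c ^ 3 = of_real (8 * t ^ 3 - 6 * t)"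
    unfolding sum prod by (simp add: power_mult_distrib)
  have "R 2 0 = of_real (2 * \<beta>) * (s ^ 3 + c ^ 3)"
    by (simp add: R_def)
  then have R2: "R 2 0 = of_real (2 * \<beta> * (8 * t ^ 3 - 6 * t))"
    unfolding cubes by simp
  have "J23 radial.F x0 T = f 1 0 * f 2 0 / 2 - f 3 0 / 6" by (rule radial.J23_F[OF Tx])
  also have "\<dots> = R 0 0 * (R 1 0 + R 0 0 ^ 2) / 2 - (R 2 0 + 3 * R 0 0 * R 1 0 + R 0 0 ^ 3) / 6"
    by (simp add: f_def \<Psi>_def)
  \<comment> \<open>\<open>R 1 0\<close> cancels, so only the first and third power sums of the
    atoms enter.\<close>
  also have "\<dots> = R 0 0 ^ 3 / 3 - R 2 0 / 6"
    by (simp add: power2_eq_square power3_eq_cube field_simps)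
  also have "\<dots> = of_real ((2 * \<beta> * t) ^ 3 / 3 - 2 * \<beta> * (8 * t ^ 3 - 6 * t) / 6)"
    unfolding R0 R2 by simp
  also have "(2 * \<beta> * t) ^ 3 / 3 - 2 * \<beta> * (8 * t ^ 3 - 6 * t) / 6
      = 2 * \<beta> * (3 * t - (4 - 4 * \<beta>\<^sup>2) * t ^ 3) / 3"
    by (simp add: power2_eq_square power3_eq_cube field_simps)
  also have "\<dots> = J23_bound \<alpha>" unfolding att by (simp add: \<beta>_def)
  finally have J: "J23 radial.F x0 T = of_real (J23_bound \<alpha>)" .
  \<comment> \<open>The cubic vanishes at \<open>t = 0\<close>, so its upper bound is
    nonnegative.\<close>
  have "0 \<le> J23_bound \<alpha>"
    using extremal_cubic_bound[of 0 \<beta>] \<alpha> by (simp add: \<beta>_def)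
  then have "cmod (J23 radial.F x0 T) = J23_bound \<alpha>" by (simp add: J)
  then show thesis
    by (rule that[OF radial.locally_biholomorphic_F radial.radial_expansion_F radial.starlike_F])
qed

theorem theorem4p2:
  fixes \<alpha> :: real
  assumes nonzero: "\<exists>x::'a::complex_banach. x \<noteq> 0"
    and \<alpha>: "0 \<le> \<alpha>" "\<alpha> < 1"
  shows "(\<forall>(F :: 'a \<Rightarrow> 'a) H x0 T.
            locally_biholomorphic F \<and> radial_expansion F H \<and> F \<in> starlike_of_order \<alpha> \<and>
            norm x0 = 1 \<and> T \<in> support_functionals x0
            \<longrightarrow> cmod (J23 F x0 T) \<le> J23_bound \<alpha>) \<and>
         (\<exists>(F :: 'a \<Rightarrow> 'a) H x0 T.
            locally_biholomorphic F \<and> radial_expansion F H \<and> F \<in> starlike_of_order \<alpha> \<and>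
            norm x0 = 1 \<and> T \<in> support_functionals x0 \<and>
            cmod (J23 F x0 T) = J23_bound \<alpha>)"
proof
  show "\<forall>(F :: 'a \<Rightarrow> 'a) H x0 T.
            locally_biholomorphic F \<and> radial_expansion F H \<and> F \<in> starlike_of_order \<alpha> \<and>
            norm x0 = 1 \<and> T \<in> support_functionals x0
            \<longrightarrow> cmod (J23 F x0 T) \<le> J23_bound \<alpha>"
    using J23_le_bound \<alpha> by blast
  obtain x :: 'a where "x \<noteq> 0" using nonzero by blast
  then have x0: "norm ((1 / norm x) *\<^sub>R x) = 1" by simp
  then have "(1 / norm x) *\<^sub>R x \<noteq> 0" by force
  then obtain T where T: "T \<in> support_functionals ((1 / norm x) *\<^sub>R x)"
    by (rule support_functional_exists)
  show "\<exists>(F :: 'a \<Rightarrow> 'a) H x0 T.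
            locally_biholomorphic F \<and> radial_expansion F H \<and> F \<in> starlike_of_order \<alpha> \<and>
            norm x0 = 1 \<and> T \<in> support_functionals x0 \<and>
            cmod (J23 F x0 T) = J23_bound \<alpha>"
    using extremal_map_exists[OF x0 T \<alpha>] x0 T by metis
qed

end
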